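(* Let $X\neq\{0\}$ be a complex Banach space with norm $\|\cdot\|$ and open unit ball $\mathbb{B}=\{z\in X:\|z\|<1\}$. Let $f:\mathbb{B}\to\mathbb{C}$ be holomorphic with $f(0)=1$, and let $F:\mathbb{B}\to X$ be defined by $F(z)=z f(z)$ (the scalar $f(z)$ times the vector $z$). If $F\in\mathcal{S}^*(\mathbb{B})$, then for every $z\in X\setminus\{0\}$ and every $l_z\in T_z$, $$\left| \left( \frac{ l_z (D^2 F(0) (z^2))}{2!\, \| z \|^2} \right) \left( \frac{ l_z (D^3 F(0) (z^3))}{3!\, \| z \|^3} \right) - \frac{ l_z (D^4 F(0) (z^4))}{4!\, \| z \|^4} \right| \leq 2 .$$ The bound is sharp, i.e. the constant $2$ on the right-hand side cannot be replaced by any smaller constant valid for all such $F$, $z$ and $l_z$.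
   Context: For $z\in X\setminus\{0\}$, $T_z=\{l_z\in L(X,\mathbb{C}): l_z(z)=\|z\|,\ \|l_z\|=1\}$, where $L(X,Y)$ is the space of continuous linear operators from $X$ to $Y$; $T_z$ is non-empty by the Hahn–Banach theorem. For a holomorphic map $F:\mathbb{B}\to X$, $D^nF(0)$ denotes the $n$-th Fréchet derivative of $F$ at $0$ (a bounded symmetric $n$-linear map $X^n\to X$), and $D^nF(0)(z^n)=D^nF(0)(z,z,\dots,z)$ ($n$ times). $DF(z)$ is the first Fréchet derivative. A holomorphic map $F:\mathbb{B}\to X$ is normalized if $F(0)=0$ and $DF(0)=I$ (the identity operator on $X$). It is locally biholomorphic if $DF(z)$ has a bounded inverse for every $z\in\mathbb{B}$. $\mathcal{S}^*(\mathbb{B})$ (starlike mappings on $\mathbb{B}$) is the class of all normalized locally biholomorphic mappings $F:\mathbb{B}\to X$ such that $$\operatorname{Re}\big(l_z([DF(z)]^{-1}F(z))\big)>0\quad\text{for all } z\in\mathbb{B}\setminus\{0\}\text{ and all } l_z\in T_z.$$ *)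

theory Defs
  imports "HOL-Analysis.Analysis"
begin

class complex_normed_vector = real_normed_vector +
  fixes scaleC :: "complex \<Rightarrow> 'a \<Rightarrow> 'a"  (infixr \<open>*\<^sub>C\<close> 75)
  assumes scaleC_add_right: "c *\<^sub>C (x + y) = c *\<^sub>C x + c *\<^sub>C y"
    and scaleC_add_left: "(c + d) *\<^sub>C x = c *\<^sub>C x + d *\<^sub>C x"
    and scaleC_scaleC: "c *\<^sub>C d *\<^sub>C x = (c * d) *\<^sub>C x"
    and scaleC_of_real: "complex_of_real r *\<^sub>C x = r *\<^sub>R x"
    and norm_scaleC: "norm (c *\<^sub>C x) = cmod c * norm x"

class complex_banach = complex_normed_vector + banach

instantiation complex :: complex_banach
begin

definition scaleC_complex :: "complex \<Rightarrow> complex \<Rightarrow> complex"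
  where "scaleC_complex c x = c * x"

instance
  by standard (simp_all add: scaleC_complex_def algebra_simps norm_mult scaleR_conv_of_real)

end

definition bounded_clinear ::
    "('a::complex_normed_vector \<Rightarrow> 'b::complex_normed_vector) \<Rightarrow> bool"
  where "bounded_clinear T \<longleftrightarrow>
    bounded_linear T \<and> (\<forall>c x. T (c *\<^sub>C x) = c *\<^sub>C T x)"

(* Complex Frechet differentiability at every point of S; S is meant to be open. *)
definition frechet_holomorphic_on ::
    "('a::complex_normed_vector \<Rightarrow> 'b::complex_normed_vector) \<Rightarrow> 'a set \<Rightarrow> bool"
  where "frechet_holomorphic_on F S \<longleftrightarrow>
    (\<forall>z\<in>S. \<exists>F'. bounded_clinear F' \<and> (F has_derivative F') (at z))"

(* The Frechet derivative as an operator-valued map, so that it can be iterated: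
   the n-fold iterate at z lies in L(X, L(X, ..., L(X, Y))), which is identified with
   the n-linear maps, and D^n F(z)(v_1, ..., v_n) is successive application to the v_i.
   Types are real-linear operators; for a holomorphic map the real and the complex
   Frechet derivative coincide, at every order, and so do the operator norms. *)
definition fderiv ::
    "('a::real_normed_vector \<Rightarrow> 'b::real_normed_vector) \<Rightarrow> 'a \<Rightarrow> 'a \<Rightarrow>\<^sub>L 'b"
  where "fderiv F z = Blinfun (frechet_derivative F (at z))"

definition support_functionals :: "'a::complex_normed_vector \<Rightarrow> ('a \<Rightarrow> complex) set"
  where "support_functionals z =
    {l. bounded_clinear l \<and> l z = complex_of_real (norm z) \<and> onorm l = 1}"

definition normalized :: "('a::complex_normed_vector \<Rightarrow> 'a) \<Rightarrow> bool"
  where "normalized F \<longleftrightarrow>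
    frechet_holomorphic_on F (ball 0 1) \<and> F 0 = 0 \<and> fderiv F 0 = id_blinfun"

definition locally_biholomorphic :: "('a::complex_normed_vector \<Rightarrow> 'a) \<Rightarrow> bool"
  where "locally_biholomorphic F \<longleftrightarrow>
    (\<forall>z\<in>ball 0 1. \<exists>G. bounded_clinear G \<and>
       (\<forall>x. G (blinfun_apply (fderiv F z) x) = x) \<and>
       (\<forall>x. blinfun_apply (fderiv F z) (G x) = x))"

(* Only the values on the open unit ball matter for membership. *)
definition starlike_mappings :: "('a::complex_normed_vector \<Rightarrow> 'a) set"
  where "starlike_mappings =
    {F. normalized F \<and> locally_biholomorphic F \<and>
        (\<forall>z \<in> ball 0 1 - {0}. \<forall>l \<in> support_functionals z.
           Re (l (inv (blinfun_apply (fderiv F z)) (F z))) > 0)}"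

end

theory Submission
  imports Defs "HOL-Complex_Analysis.Complex_Analysis"
begin

text \<open>
  On the complex line through a unit vector \<open>w\<close>, the map \<open>F z = f z *\<^sub>C z\<close> is \<open>h \<zeta> *\<^sub>C w\<close> with
  \<open>h \<zeta> = \<zeta> * f (\<zeta> *\<^sub>C w)\<close>. The derivative of \<open>F\<close> at \<open>z\<close> is a rank-one perturbation of a multiple
  of the identity, so its inverse sends \<open>F z\<close> to a multiple of \<open>z\<close>, and starlikeness of \<open>F\<close> makes
  \<open>h\<close> a starlike function of the disc with coefficients \<open>a\<^sub>2, a\<^sub>3, a\<^sub>4\<close> equal to the three quotients of
  the theorem. Writing \<open>\<zeta> h' / h = (1 + \<zeta> \<phi>) / (1 - \<zeta> \<phi>)\<close> with \<open>\<bar>\<phi>\<bar> \<le> 1\<close> and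
  \<open>\<phi> = c\<^sub>0 + c\<^sub>1 \<zeta> + c\<^sub>2 \<zeta>\<^sup>2 + \<dots>\<close>, one finds \<open>a\<^sub>2 a\<^sub>3 - a\<^sub>4 = (2/3) (3 c\<^sub>0\<^sup>3 - 2 c\<^sub>0 c\<^sub>1 - c\<^sub>2)\<close>, and the
  Schwarz-Pick bounds \<open>\<bar>c\<^sub>1\<bar>, \<bar>c\<^sub>2\<bar> \<le> 1 - \<bar>c\<^sub>0\<bar>\<^sup>2\<close> finish the estimate. Equality holds for
  \<open>f z = 1 / (1 - l z)\<^sup>2\<close>, where \<open>l\<close> is a support functional given by the Hahn-Banach theorem.

  The iterated derivatives exist because the derivative of a holomorphic map between complex Banach
  spaces is again holomorphic in the operator norm: the Cauchy estimate transfers a bound on a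
  linear combination of translates of \<open>F\<close> to the same combination of translates of its derivative.
\<close>

section \<open>Support functionals\<close>

lemma bounded_clinearD:
  assumes "bounded_clinear T"
  shows "bounded_linear T" and "T (c *\<^sub>C x) = c *\<^sub>C T x"
  using assms by (auto simp: bounded_clinear_def)

lemma scaleC_one [simp]: "1 *\<^sub>C (x::'a::complex_normed_vector) = x"
  using scaleC_of_real[of 1 x] by simp

lemma scaleC_complex_eq [simp]: "c *\<^sub>C (x::complex) = c * x"
  by (simp add: scaleC_complex_def)

lemma bounded_bilinear_scaleC:
  "bounded_bilinear (\<lambda>c (x::'a::complex_normed_vector). c *\<^sub>C x)"
proof
  fix a :: complex and r and b :: 'a
  show "(r *\<^sub>R a) *\<^sub>C b = r *\<^sub>R a *\<^sub>C b"
    by (simp add: scaleR_conv_of_real flip: scaleC_of_real scaleC_scaleC)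
  show "a *\<^sub>C r *\<^sub>R b = r *\<^sub>R a *\<^sub>C b"
    by (simp add: scaleC_scaleC mult.commute flip: scaleC_of_real)
qed (auto simp: scaleC_add_left scaleC_add_right norm_scaleC intro: exI[of _ 1])

interpretation scaleC: bounded_bilinear "\<lambda>c (x::'a::complex_normed_vector). c *\<^sub>C x"
  by (rule bounded_bilinear_scaleC)

section \<open>The Hahn-Banach theorem through minimal sublinear functionals\<close>

definition sublinear :: "('a::real_vector \<Rightarrow> real) \<Rightarrow> bool" where
  "sublinear p \<longleftrightarrow> (\<forall>x y. p (x + y) \<le> p x + p y) \<and> (\<forall>t x. 0 \<le> t \<longrightarrow> p (t *\<^sub>R x) = t * p x)"

lemma sublinearD:
  assumes "sublinear p"
  shows "p (x + y) \<le> p x + p y" "0 \<le> t \<Longrightarrow> p (t *\<^sub>R x) = t * p x" "p 0 = 0" "- p (- x) \<le> p x"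
proof -
  show "p (x + y) \<le> p x + p y" "0 \<le> t \<Longrightarrow> p (t *\<^sub>R x) = t * p x" for x y t
    using assms by (auto simp: sublinear_def)
  from this(2)[of 0 0] show 0: "p 0 = 0" by simp
  have "p (x + (- x)) \<le> p x + p (- x)" using assms unfolding sublinear_def by blast
  then show "- p (- x) \<le> p x" using 0 by simp
qed

text \<open>For sublinear \<open>p\<close> this is the largest sublinear functional below
  \<open>p\<close> whose value at \<open>- y\<close> is at most \<open>- p y\<close>. It can
  coincide with \<open>p\<close> only if \<open>p\<close> is additive in the direction
  \<open>y\<close>, which is how minimality is turned into linearity.\<close>

definition sublinear_shift :: "('a::real_vector \<Rightarrow> real) \<Rightarrow> 'a \<Rightarrow> 'a \<Rightarrow> real" where
  "sublinear_shift p y x = (INF t\<in>{0..}. p (x + t *\<^sub>R y) - t * p y)"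

text \<open>A real \<open>INF\<close> carries information only for a set bounded below. Splitting
  \<open>t *\<^sub>R y\<close> as \<open>(x + t *\<^sub>R y) + (- x)\<close> gives a lower bound
  uniform in \<open>t\<close>.\<close>

lemma sublinear_shift_bdd:
  assumes "sublinear p"
  shows "bdd_below ((\<lambda>t. p (x + t *\<^sub>R y) - t * p y) ` {0..})"
proof (rule bdd_belowI2)
  fix t :: real assume "t \<in> {0..}"
  then have "t * p y = p ((x + t *\<^sub>R y) + (- x))" using sublinearD[OF assms] by simp
  also have "\<dots> \<le> p (x + t *\<^sub>R y) + p (- x)" using sublinearD[OF assms] by blast
  finally show "- p (- x) \<le> p (x + t *\<^sub>R y) - t * p y" by simp
qed

lemma sublinear_shift_le:
  assumes "sublinear p" "0 \<le> t"
  shows "sublinear_shift p y x \<le> p (x + t *\<^sub>R y) - t * p y"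
  unfolding sublinear_shift_def
  by (rule cINF_lower[OF sublinear_shift_bdd[OF assms(1)]]) (use assms in auto)

lemma sublinear_shift_greatest:
  assumes "\<And>t. 0 \<le> t \<Longrightarrow> c \<le> p (x + t *\<^sub>R y) - t * p y"
  shows "c \<le> sublinear_shift p y x"
  unfolding sublinear_shift_def by (rule cINF_greatest) (use assms in auto)

lemma sublinear_sublinear_shift:
  assumes p: "sublinear p"
  shows "sublinear (sublinear_shift p y)"
  unfolding sublinear_def
proof (intro conjI allI impI)
  note le = sublinear_shift_le[OF p]
  note gr = sublinear_shift_greatest[of _ p]
  fix a b
  \<comment> \<open>The parameters for \<open>a\<close> and \<open>b\<close> vary independently and
    \<open>t + s\<close> is admissible for \<open>a + b\<close>, so the two infima can be taken one
    after the other.\<close>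
  have 1: "sublinear_shift p y (a + b) \<le> (p (a + t *\<^sub>R y) - t * p y) + (p (b + s *\<^sub>R y) - s * p y)"
    if "0 \<le> t" "0 \<le> s" for s t
  proof -
    have "p ((a + b) + (t + s) *\<^sub>R y) \<le> p (a + t *\<^sub>R y) + p (b + s *\<^sub>R y)"
      using sublinearD(1)[OF p, of "a + t *\<^sub>R y" "b + s *\<^sub>R y"] by (simp add: algebra_simps)
    with le[of "t + s" y "a + b"] that show ?thesis by (simp add: algebra_simps)
  qed
  have "sublinear_shift p y (a + b) - (p (b + s *\<^sub>R y) - s * p y) \<le> sublinear_shift p y a"
    if "0 \<le> s" for s
    by (rule gr) (use 1 that in \<open>simp add: algebra_simps\<close>)
  then have "sublinear_shift p y (a + b) - sublinear_shift p y a \<le> sublinear_shift p y b"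
    by (intro gr) (simp add: algebra_simps)
  then show "sublinear_shift p y (a + b) \<le> sublinear_shift p y a + sublinear_shift p y b" by simp
next
  note le = sublinear_shift_le[OF p]
  note gr = sublinear_shift_greatest[of _ p]
  have ge: "sublinear_shift p y (r *\<^sub>R x) \<le> r * sublinear_shift p y x" if "0 < r" for r x
  proof -
    have "sublinear_shift p y (r *\<^sub>R x) / r \<le> sublinear_shift p y x"
    proof (rule gr)
      fix t :: real assume "0 \<le> t"
      have "p (r *\<^sub>R x + (r * t) *\<^sub>R y) = r * p (x + t *\<^sub>R y)"
        using sublinearD(2)[OF p, of r "x + t *\<^sub>R y"] that by (simp add: algebra_simps)
      then show "sublinear_shift p y (r *\<^sub>R x) / r \<le> p (x + t *\<^sub>R y) - t * p y"
        using le[of "r * t" y "r *\<^sub>R x"] that \<open>0 \<le> t\<close> by (simp add: field_simps)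
    qed
    then show ?thesis using that by (simp add: field_simps)
  qed
  fix t :: real and x :: 'a assume "0 \<le> t"
  show "sublinear_shift p y (t *\<^sub>R x) = t * sublinear_shift p y x"
  proof (cases "t = 0")
    case True
    have "sublinear_shift p y 0 \<le> 0"
      using le[of 0 y 0] sublinearD(3)[OF p] by simp
    moreover have "0 \<le> sublinear_shift p y 0"
      by (rule gr) (use sublinearD(2)[OF p] in auto)
    ultimately show ?thesis using True by simp
  next
    case False
    with \<open>0 \<le> t\<close> have t: "0 < t" by simp
    \<comment> \<open>The reverse inequality is \<open>ge\<close> with the inverse factor, applied
      to the scaled vector.\<close>
    from ge[of "1 / t" "t *\<^sub>R x"] t have "t * sublinear_shift p y x \<le> sublinear_shift p y (t *\<^sub>R x)"
      by (simp add: field_simps)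
    with ge[OF t] show ?thesis by (simp add: antisym)
  qed
qed

text \<open>Minimal sublinear functionals are linear, so Zorn's lemma is applied to functionals defined on
  the whole space and no partial extensions occur.\<close>
lemma minimal_sublinear_exists:
  assumes q: "sublinear q"
  obtains p where "sublinear p" "p \<le> q" "\<And>p'. sublinear p' \<Longrightarrow> p' \<le> p \<Longrightarrow> p' = p"
proof -
  define A where "A = {p. sublinear p \<and> p \<le> q}"
  have "\<exists>m\<in>A. \<forall>a\<in>A. a \<le> m \<longrightarrow> a = m"
  proof (rule predicate_Zorn)
    \<comment> \<open>Zorn's lemma produces maximal elements, so the order is reversed; a chain is
      then bounded by its pointwise infimum.\<close>
    show "partial_order_on A (relation_of (\<lambda>x y. y \<le> x) A)"
      by (rule partial_order_on_relation_ofI) auto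
    fix C assume C: "C \<in> Chains (relation_of (\<lambda>x y. y \<le> x) A)"
    then have CA: "C \<subseteq> A" and tot: "\<And>f g. f \<in> C \<Longrightarrow> g \<in> C \<Longrightarrow> f \<le> g \<or> g \<le> f"
      by (auto simp: Chains_def relation_of_def)
    show "\<exists>u\<in>A. \<forall>a\<in>C. u \<le> a"
    proof (cases "C = {}")
      case True
      then show ?thesis using q by (auto simp: A_def)
    next
      case False
      define u where "u x = (INF f\<in>C. f x)" for x
      have sub: "sublinear f" and fq: "f x \<le> q x" if "f \<in> C" for f x
        using CA that by (auto simp: A_def le_fun_def)
      have bdd: "bdd_below ((\<lambda>f. f x) ` C)" for x
      proof (rule bdd_belowI2)
        fix f assume f: "f \<in> C"
        show "- q (- x) \<le> f x" using sublinearD(4)[OF sub[OF f], of x] fq[OF f, of "- x"] by simp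
      qed
      have le: "u x \<le> f x" if "f \<in> C" for f x
        unfolding u_def by (rule cINF_lower[OF bdd that])
      have gr: "c \<le> u x" if "\<And>f. f \<in> C \<Longrightarrow> c \<le> f x" for c x
        unfolding u_def by (rule cINF_greatest[OF False that])
      have "sublinear u"
        unfolding sublinear_def
      proof (intro conjI allI impI)
        fix x y
        \<comment> \<open>Two members of the chain are comparable, and subadditivity of the smaller
          one serves both summands.\<close>
        have 1: "u (x + y) \<le> f x + g y" if fg: "f \<in> C" "g \<in> C" for f g
        proof (cases "f \<le> g")
          case True
          have "u (x + y) \<le> f x + f y" using le[OF fg(1)] sublinearD(1)[OF sub[OF fg(1)]] order_trans by blast
          also have "\<dots> \<le> f x + g y" using True by (simp add: le_funD)
          finally show ?thesis .
        next
          case False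
          then have "g \<le> f" using tot fg by blast
          have "u (x + y) \<le> g x + g y" using le[OF fg(2)] sublinearD(1)[OF sub[OF fg(2)]] order_trans by blast
          also have "\<dots> \<le> f x + g y" using \<open>g \<le> f\<close> by (simp add: le_funD)
          finally show ?thesis .
        qed
        have "u (x + y) - g y \<le> u x" if "g \<in> C" for g
          by (rule gr) (use 1 that in \<open>simp add: algebra_simps\<close>)
        then have "u (x + y) - u x \<le> u y"
          by (intro gr) (simp add: algebra_simps)
        then show "u (x + y) \<le> u x + u y" by simp
      next
        fix t :: real and x :: 'a assume t: "0 \<le> t"
        show "u (t *\<^sub>R x) = t * u x"
        proof (cases "t = 0")
          case True
          then have "(\<lambda>f. f (t *\<^sub>R x)) ` C = {0}" using False sublinearD(3)[OF sub] by (force simp: image_iff)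
          then show ?thesis using True by (simp add: u_def)
        next
          case False
          with t have t: "0 < t" by simp
          have "u (t *\<^sub>R x) / t \<le> u x"
          proof (rule gr)
            fix f assume f: "f \<in> C"
            show "u (t *\<^sub>R x) / t \<le> f x"
              using le[OF f, of "t *\<^sub>R x"] sublinearD(2)[OF sub[OF f], of t x] t by (simp add: field_simps)
          qed
          moreover have "t * u x \<le> u (t *\<^sub>R x)"
          proof (rule gr)
            fix f assume f: "f \<in> C"
            show "t * u x \<le> f (t *\<^sub>R x)"
              using le[OF f, of x] sublinearD(2)[OF sub[OF f], of t x] t by simp
          qed
          ultimately show ?thesis using t by (simp add: field_simps)
        qed
      qed
      moreover have "u \<le> q"
      proof (rule le_funI)
        fix x
        obtain f where "f \<in> C" using False by blast
        then show "u x \<le> q x" using le[of f x] fq[of f x] by simp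
      qed
      ultimately show ?thesis using le by (auto simp: A_def le_fun_def)
    qed
  qed
  then obtain m where m: "m \<in> A" "\<And>a. a \<in> A \<Longrightarrow> a \<le> m \<Longrightarrow> a = m" by blast
  show ?thesis
  proof (rule that[of m])
    show "sublinear m" "m \<le> q" using m(1) by (auto simp: A_def)
    then show "p' = m" if "sublinear p'" "p' \<le> m" for p'
      using m(2)[of p'] that order_trans[of p' m q] by (auto simp: A_def)
  qed
qed

text \<open>The shift in direction \<open>y\<close> is sublinear and, by \<open>t = 0\<close>, lies
  below \<open>p\<close>, so minimality makes it equal to \<open>p\<close>. The choice
  \<open>t = 1\<close> then gives superadditivity.\<close>

lemma minimal_sublinear_imp_linear:
  assumes p: "sublinear p" and min: "\<And>p'. sublinear p' \<Longrightarrow> p' \<le> p \<Longrightarrow> p' = p"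
  shows "linear p"
proof -
  have add: "p (x + y) = p x + p y" for x y
  proof -
    have "sublinear_shift p y = p"
      by (rule min[OF sublinear_sublinear_shift[OF p]])
         (use sublinear_shift_le[OF p, of 0] in \<open>simp add: le_fun_def\<close>)
    with sublinear_shift_le[OF p, of 1 y x] have "p x \<le> p (x + y) - p y" by simp
    with sublinearD(1)[OF p, of x y] show ?thesis by simp
  qed
  have neg: "p (- x) = - p x" for x
    using add[of x "- x"] sublinearD(3)[OF p] by simp
  have "p (r *\<^sub>R x) = r * p x" for r x
    using sublinearD(2)[OF p, of r x] sublinearD(2)[OF p, of "- r" x] neg[of "r *\<^sub>R x"]
    by (cases "0 \<le> r") auto
  with add show ?thesis by (intro linearI) auto
qed

text \<open>Domination by the norm alone leaves the value at \<open>x0\<close> open. Starting from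
  the norm shifted in direction \<open>x0\<close> forces the value at \<open>- x0\<close> down to at
  most \<open>- norm x0\<close>, and linearity turns this into the maximal value at
  \<open>x0\<close>.\<close>

lemma real_support_functional_exists:
  fixes x0 :: "'a::real_normed_vector"
  obtains u where "linear u" "\<And>x. u x \<le> norm x" "u x0 = norm x0"
proof -
  have n: "sublinear (norm :: 'a \<Rightarrow> real)"
    by (auto simp: sublinear_def norm_triangle_ineq)
  define q where "q = sublinear_shift (norm :: 'a \<Rightarrow> real) x0"
  have q: "sublinear q" unfolding q_def by (rule sublinear_sublinear_shift[OF n])
  have q1: "q x \<le> norm x" for x
    using sublinear_shift_le[OF n, of 0 x0 x] by (simp add: q_def)
  have q2: "q (- x0) \<le> - norm x0"
    using sublinear_shift_le[OF n, of 1 x0 "- x0"] by (simp add: q_def)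
  obtain p where p: "sublinear p" "p \<le> q" "\<And>p'. sublinear p' \<Longrightarrow> p' \<le> p \<Longrightarrow> p' = p"
    by (rule minimal_sublinear_exists[OF q]) blast
  have lin: "linear p" by (rule minimal_sublinear_imp_linear[OF p(1,3)])
  have le: "p x \<le> norm x" for x using le_funD[OF p(2), of x] q1[of x] by simp
  have "p (- x0) \<le> - norm x0" using le_funD[OF p(2), of "- x0"] q2 by simp
  then have "p x0 = norm x0" using le[of x0] linear_neg[OF lin, of x0] by simp
  with lin le show ?thesis by (rule that)
qed

theorem support_functionals_nonempty:
  fixes x0 :: "'a::complex_normed_vector"
  assumes "x0 \<noteq> 0"
  obtains l where "l \<in> support_functionals x0"
proof -
  obtain u where u: "linear u" "\<And>x. u x \<le> norm x" "u x0 = norm x0"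
    using real_support_functional_exists[of x0] by blast
  \<comment> \<open>A complex-linear functional is determined by its real part; this is the only one
    with real part \<open>u\<close>.\<close>
  define l where "l x = Complex (u x) (- u (\<i> *\<^sub>C x))" for x
  note usimps = linear_add[OF u(1)] linear_scale[OF u(1)] linear_neg[OF u(1)]
  have ladd: "l (x + y) = l x + l y" for x y
    by (simp add: l_def usimps scaleC_add_right complex_eq_iff)
  have lR: "l (r *\<^sub>R x) = r *\<^sub>R l x" for r x
    by (simp add: l_def usimps scaleC.scaleR_right complex_eq_iff)
  have iiC: "\<i> *\<^sub>C \<i> *\<^sub>C x = - x" for x :: 'a
    using scaleC_of_real[of "-1" x] by (simp add: scaleC_scaleC)
  have li: "l (\<i> *\<^sub>C x) = \<i> * l x" for x
    by (simp add: l_def usimps iiC complex_eq_iff)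
  have dec: "c *\<^sub>C x = Re c *\<^sub>R x + Im c *\<^sub>R \<i> *\<^sub>C x" for c and x :: 'a
  proof -
    have "complex_of_real (Re c) + complex_of_real (Im c) * \<i> = c"
      by (simp add: complex_eq_iff)
    then show ?thesis by (metis scaleC_add_left scaleC_of_real scaleC_scaleC)
  qed
  have lC: "l (c *\<^sub>C x) = c * l x" for c x
    by (subst dec) (simp add: ladd lR li complex_eq_iff)
  have lb: "cmod (l x) \<le> norm x" for x
  proof (cases "l x = 0")
    case False
    \<comment> \<open>Multiplication by the unimodular \<open>e\<close> rotates \<open>l x\<close>
      onto the nonnegative real axis, where \<open>l\<close> agrees with \<open>u\<close>.\<close>
    define e where "e = cnj (l x) / cmod (l x)"
    have "cmod e = 1" using False by (simp add: e_def norm_divide)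
    have "l (e *\<^sub>C x) = (l x * cnj (l x)) / cmod (l x)" by (simp add: lC e_def)
    also have "\<dots> = cmod (l x)"
      using False by (simp add: power2_eq_square flip: complex_norm_square)
    finally have "l (e *\<^sub>C x) = cmod (l x)" .
    then have "cmod (l x) = Re (l (e *\<^sub>C x))" by simp
    also have "\<dots> = u (e *\<^sub>C x)" by (simp add: l_def)
    also have "\<dots> \<le> norm x" using u(2)[of "e *\<^sub>C x"] \<open>cmod e = 1\<close> by (simp add: norm_scaleC)
    finally show ?thesis .
  qed auto
  have bl: "bounded_linear l"
    by (rule bounded_linear_intro[of _ 1]) (use ladd lR lb in auto)
  have "Re (l x0) = norm x0" by (simp add: l_def u)
  \<comment> \<open>The real part already exhausts the bound
    \<open>cmod (l x0) \<le> norm x0\<close>.\<close>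
  moreover have "Im (l x0) = 0"
    using power_mono[OF lb[of x0], of 2] \<open>Re (l x0) = norm x0\<close> by (simp add: cmod_power2)
  ultimately have lx0: "l x0 = complex_of_real (norm x0)" by (simp add: complex_eq_iff)
  have "onorm l = 1"
  proof (rule antisym)
    show "onorm l \<le> 1" by (rule onorm_bound) (use lb in auto)
    have "norm (l x0) \<le> onorm l * norm x0" by (rule onorm[OF bl])
    then show "1 \<le> onorm l" using assms by (simp add: lx0)
  qed
  then have "l \<in> support_functionals x0"
    using bl lC lx0 by (simp add: support_functionals_def bounded_clinear_def)
  then show ?thesis by (rule that)
qed

section \<open>Holomorphic maps between Banach spaces\<close>

lemma bounded_linear_scaleC_blinfun:
  fixes T :: "'a::real_normed_vector \<Rightarrow>\<^sub>L 'b::complex_normed_vector"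
  shows "bounded_linear (\<lambda>x. c *\<^sub>C T x)"
  by (rule bounded_linear_compose[OF scaleC.bounded_linear_right blinfun.bounded_linear_right])

text \<open>With scalars acting on the values, the spaces containing the iterated
  \<open>fderiv\<close> become complex Banach spaces when the target is one. Holomorphy then makes
  sense for \<open>fderiv F\<close> itself, and results about \<open>F\<close> can be applied to it
  again.\<close>

instantiation blinfun :: (real_normed_vector, complex_normed_vector) complex_normed_vector
begin

definition scaleC_blinfun :: "complex \<Rightarrow> 'a \<Rightarrow>\<^sub>L 'b \<Rightarrow> 'a \<Rightarrow>\<^sub>L 'b"
  where "scaleC_blinfun c T = Blinfun (\<lambda>x. c *\<^sub>C T x)"

lemma scaleC_blinfun_apply: "blinfun_apply (c *\<^sub>C T) x = c *\<^sub>C T x" for T :: "'a \<Rightarrow>\<^sub>L 'b"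
  unfolding scaleC_blinfun_def by (simp add: bounded_linear_Blinfun_apply bounded_linear_scaleC_blinfun)

instance
proof
  fix c d :: complex and r :: real and S T :: "'a \<Rightarrow>\<^sub>L 'b"
  note [simp] = scaleC_blinfun_apply blinfun.add_left blinfun.scaleR_left
  show "c *\<^sub>C (S + T) = c *\<^sub>C S + c *\<^sub>C T"
    by (rule blinfun_eqI) (simp add: scaleC_add_right)
  show "(c + d) *\<^sub>C T = c *\<^sub>C T + d *\<^sub>C T"
    by (rule blinfun_eqI) (simp add: scaleC_add_left)
  show "c *\<^sub>C d *\<^sub>C T = (c * d) *\<^sub>C T"
    by (rule blinfun_eqI) (simp add: scaleC_scaleC)
  show "complex_of_real r *\<^sub>C T = r *\<^sub>R T"
    by (rule blinfun_eqI) (simp add: scaleC_of_real)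
  have le: "norm (c *\<^sub>C T) \<le> cmod c * norm T" for c and T :: "'a \<Rightarrow>\<^sub>L 'b"
    by (rule norm_blinfun_bound)
       (simp_all add: norm_scaleC mult.assoc mult_left_mono norm_blinfun)
  show "norm (c *\<^sub>C T) = cmod c * norm T"
  proof (cases "c = 0")
    case True
    then show ?thesis using le[of 0 T] by simp
  next
    case False
    have "T = inverse c *\<^sub>C c *\<^sub>C T"
      using False by (intro blinfun_eqI) (simp add: scaleC_scaleC)
    then have "norm T \<le> cmod (inverse c) * norm (c *\<^sub>C T)" by (metis le)
    then have "cmod c * norm T \<le> norm (c *\<^sub>C T)"
      using False by (simp add: norm_inverse norm_divide field_simps)
    with le[of c T] show ?thesis by simp
  qed
qed

end

instance blinfun :: (real_normed_vector, complex_banach) complex_banach ..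

text \<open>The derivative is carried as an operator, so that a linear combination of maps comes
  with the same combination of derivatives, ready for an operator norm estimate.\<close>

definition has_cderiv ::
    "('a::complex_normed_vector \<Rightarrow> 'b::complex_normed_vector) \<Rightarrow> 'a \<Rightarrow>\<^sub>L 'b \<Rightarrow> 'a \<Rightarrow> bool"
  where "has_cderiv F T z \<longleftrightarrow>
    (F has_derivative blinfun_apply T) (at z) \<and> (\<forall>c x. T (c *\<^sub>C x) = c *\<^sub>C T x)"

lemma has_cderivD:
  assumes "has_cderiv F T z"
  shows "(F has_derivative blinfun_apply T) (at z)" "T (c *\<^sub>C x) = c *\<^sub>C T x"
  using assms by (auto simp: has_cderiv_def)

lemma fderiv_eqI: "(F has_derivative F') (at z) \<Longrightarrow> blinfun_apply (fderiv F z) = F'"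
  unfolding fderiv_def
  by (metis bounded_linear_Blinfun_apply frechet_derivative_at has_derivative_bounded_linear)

lemma has_cderiv_imp_fderiv: "has_cderiv F T z \<Longrightarrow> fderiv F z = T"
  by (rule blinfun_eqI) (simp add: fderiv_eqI[OF has_cderivD(1)])

lemma frechet_holomorphic_on_iff:
  "frechet_holomorphic_on F S \<longleftrightarrow> (\<forall>z\<in>S. has_cderiv F (fderiv F z) z)"
proof -
  have "(\<exists>F'. bounded_clinear F' \<and> (F has_derivative F') (at z)) \<longleftrightarrow> has_cderiv F (fderiv F z) z" for z
  proof
    assume "\<exists>F'. bounded_clinear F' \<and> (F has_derivative F') (at z)"
    then obtain F' where "bounded_clinear F'" "(F has_derivative F') (at z)" by blast
    then show "has_cderiv F (fderiv F z) z"
      by (simp add: has_cderiv_def fderiv_eqI bounded_clinear_def)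
  next
    assume "has_cderiv F (fderiv F z) z"
    then show "\<exists>F'. bounded_clinear F' \<and> (F has_derivative F') (at z)"
      unfolding has_cderiv_def bounded_clinear_def
      by (intro exI[of _ "blinfun_apply (fderiv F z)"]) (simp add: blinfun.bounded_linear_right)
  qed
  then show ?thesis by (simp add: frechet_holomorphic_on_def)
qed

lemma has_cderiv_diff:
  "has_cderiv F S z \<Longrightarrow> has_cderiv G T z \<Longrightarrow> has_cderiv (\<lambda>z. F z - G z) (S - T) z"
  unfolding has_cderiv_def
  by (auto simp: blinfun.diff_left[abs_def] scaleC.diff_right intro: has_derivative_diff)

lemma has_cderiv_scaleC:
  "has_cderiv F T z \<Longrightarrow> has_cderiv (\<lambda>z. c *\<^sub>C F z) (c *\<^sub>C T) z"
  unfolding has_cderiv_def scaleC_blinfun_apply[abs_def]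
  by (auto simp: scaleC_scaleC mult.commute
      intro: bounded_linear.has_derivative[OF scaleC.bounded_linear_right])

lemma has_cderiv_shift:
  assumes "has_cderiv F T (z + h)"
  shows "has_cderiv (\<lambda>z. F (z + h)) T z"
proof -
  have "((\<lambda>z. F (z + h)) has_derivative (\<lambda>x. T x)) (at z)"
    by (rule has_derivative_compose[of "\<lambda>z. z + h" "\<lambda>x. x"])
       (use has_cderivD(1)[OF assms] in \<open>auto intro!: derivative_eq_intros\<close>)
  with has_cderivD(2)[OF assms] show ?thesis by (auto simp: has_cderiv_def)
qed

section \<open>Cauchy estimates for vector-valued holomorphic maps\<close>

lemma bounded_clinear_has_field_derivative:
  assumes l: "bounded_clinear l" and G: "has_cderiv G T \<zeta>"
  shows "((\<lambda>\<zeta>. l (G \<zeta>)) has_field_derivative l (T 1)) (at (\<zeta>::complex))"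
proof -
  have "((\<lambda>\<zeta>. l (G \<zeta>)) has_derivative (\<lambda>h. l (T h))) (at \<zeta>)"
    by (rule bounded_linear.has_derivative[OF bounded_clinearD(1)[OF l] has_cderivD(1)[OF G]])
  moreover have "(\<lambda>h. l (T h)) = (*) (l (T 1))"
  proof
    fix h
    have "T h = h *\<^sub>C T 1" using has_cderivD(2)[OF G, of h 1] by simp
    then show "l (T h) = l (T 1) * h"
      by (simp only: bounded_clinearD(2)[OF l] scaleC_complex_eq mult.commute)
  qed
  ultimately show ?thesis by (simp only: has_field_derivative_def)
qed

text \<open>The support functional of the derivative reduces the estimate to scalar functions.\<close>
lemma cauchy_estimate_vector:
  fixes G :: "complex \<Rightarrow> 'b::complex_normed_vector"
  assumes r: "0 < r" and G: "\<And>\<zeta>. \<zeta> \<in> ball 0 r \<Longrightarrow> has_cderiv G (T \<zeta>) \<zeta>"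
    and M: "\<And>\<zeta>. \<zeta> \<in> ball 0 r \<Longrightarrow> norm (G \<zeta>) \<le> M"
  shows "norm (T 0 1) \<le> M / r"
proof (cases "T 0 1 = 0")
  case True
  then show ?thesis using M[of 0] r by (simp add: order_trans[OF norm_ge_zero])
next
  case False
  then obtain l where l: "l \<in> support_functionals (T 0 1)"
    by (rule support_functionals_nonempty)
  then have lc: "bounded_clinear l" and l1: "l (T 0 1) = complex_of_real (norm (T 0 1))"
    and lo: "onorm l = 1"
    by (auto simp: support_functionals_def)
  have lb: "cmod (l y) \<le> norm y" for y
    using onorm[OF bounded_clinearD(1)[OF lc], of y] lo by simp
  define g where "g = (\<lambda>\<zeta>. l (G \<zeta>))"
  have g: "(g has_field_derivative l (T \<zeta> 1)) (at \<zeta>)" if "\<zeta> \<in> ball 0 r" for \<zeta>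
    unfolding g_def by (rule bounded_clinear_has_field_derivative[OF lc G[OF that]])
  have gM: "cmod (g \<zeta>) \<le> M" if "\<zeta> \<in> ball 0 r" for \<zeta>
    unfolding g_def using lb M[OF that] by (rule order_trans)
  have hol: "g holomorphic_on ball 0 r"
    using g unfolding holomorphic_on_open[OF open_ball] by blast
  have d0: "deriv g 0 = complex_of_real (norm (T 0 1))"
    using g[of 0] r l1 by (simp add: DERIV_imp_deriv)
  \<comment> \<open>The bound \<open>M\<close> is known only on the open disc, so Cauchy's
    inequality is used on circles of radius \<open>s < r\<close>. Solving for the radius makes the
    passage to \<open>r\<close> a density argument.\<close>
  have "r \<le> M / norm (T 0 1)"
  proof (rule dense_le_bounded[OF r])
    fix s assume s: "0 < s" "s < r"
    have "cmod ((deriv ^^ 1) g 0) \<le> fact 1 * M / s ^ 1"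
    proof (rule Cauchy_inequality)
      show "g holomorphic_on ball 0 s"
        using hol by (rule holomorphic_on_subset) (use s in auto)
      show "continuous_on (cball 0 s) g"
        by (rule continuous_on_subset[OF holomorphic_on_imp_continuous_on[OF hol]]) (use s in auto)
      show "cmod (g x) \<le> M" if "cmod (0 - x) = s" for x
        using that s by (intro gM) auto
    qed (use s in auto)
    then show "s \<le> M / norm (T 0 1)"
      using s False d0 by (simp add: field_simps)
  qed
  then show ?thesis using r False by (simp add: field_simps)
qed

text \<open>On the complex line through \<open>z\<close> in direction \<open>v\<close> the map is a
  function of one variable, defined on a disc of radius \<open>r / norm v\<close>; its derivative at
  the centre is \<open>T z v\<close>.\<close>

lemma cauchy_estimate_frechet:
  fixes G :: "'a::complex_normed_vector \<Rightarrow> 'b::complex_normed_vector"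
  assumes r: "0 < r" and G: "\<And>w. w \<in> ball z r \<Longrightarrow> has_cderiv G (T w) w"
    and M: "\<And>w. w \<in> ball z r \<Longrightarrow> norm (G w) \<le> M"
  shows "norm (T z) \<le> M / r"
proof (rule norm_blinfun_bound)
  have "0 \<le> M" using M[of z] r order_trans[OF norm_ge_zero] by auto
  then show "0 \<le> M / r" using r by simp
  fix v
  show "norm (T z v) \<le> M / r * norm v"
  proof (cases "v = 0")
    case False
    define \<rho> where "\<rho> = r / norm v"
    have \<rho>: "0 < \<rho>" using r False by (simp add: \<rho>_def)
    define P where "P = Blinfun (\<lambda>\<zeta>. \<zeta> *\<^sub>C v)"
    have P: "P \<zeta> = \<zeta> *\<^sub>C v" for \<zeta>
      unfolding P_def by (simp add: bounded_linear_Blinfun_apply scaleC.bounded_linear_left)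
    have inb: "z + \<zeta> *\<^sub>C v \<in> ball z r" if "\<zeta> \<in> ball 0 \<rho>" for \<zeta>
      using that False by (simp add: \<rho>_def dist_norm norm_scaleC field_simps)
    have "norm ((T (z + 0 *\<^sub>C v) o\<^sub>L P) 1) \<le> M / \<rho>"
    proof (rule cauchy_estimate_vector[OF \<rho>, where G="\<lambda>\<zeta>. G (z + \<zeta> *\<^sub>C v)"])
      fix \<zeta> :: complex assume \<zeta>: "\<zeta> \<in> ball 0 \<rho>"
      note G' = G[OF inb[OF \<zeta>]]
      have "((\<lambda>\<zeta>. G (z + \<zeta> *\<^sub>C v)) has_derivative (\<lambda>h. T (z + \<zeta> *\<^sub>C v) (h *\<^sub>C v))) (at \<zeta>)"
        by (rule has_derivative_compose[of "\<lambda>\<zeta>. z + \<zeta> *\<^sub>C v" "\<lambda>h. h *\<^sub>C v"])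
           (use has_cderivD(1)[OF G'] in
            \<open>auto intro!: derivative_eq_intros bounded_linear_imp_has_derivative scaleC.bounded_linear_left\<close>)
      moreover have "blinfun_apply (T (z + \<zeta> *\<^sub>C v) o\<^sub>L P) = (\<lambda>h. T (z + \<zeta> *\<^sub>C v) (h *\<^sub>C v))"
        by (rule ext) (simp add: P)
      ultimately show "has_cderiv (\<lambda>\<zeta>. G (z + \<zeta> *\<^sub>C v)) (T (z + \<zeta> *\<^sub>C v) o\<^sub>L P) \<zeta>"
        using has_cderivD(2)[OF G'] by (simp add: has_cderiv_def flip: scaleC_scaleC)
      show "norm (G (z + \<zeta> *\<^sub>C v)) \<le> M" by (rule M[OF inb[OF \<zeta>]])
    qed
    then show ?thesis by (simp add: P \<rho>_def scaleC.zero_left)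
  qed simp
qed

section \<open>Holomorphy of the Frechet derivative\<close>

text \<open>An operator that is linear up to a quadratic error differs from a linear one,
  its limit under the rescalings \<open>2 ^ n * E (h / 2 ^ n)\<close>, by a quadratic error only.\<close>
lemma quasilinear_has_derivative:
  fixes E :: "'a::complex_normed_vector \<Rightarrow> 'b::complex_banach"
  assumes \<rho>: "0 < \<rho>" and K: "0 \<le> K"
    and hom: "\<And>c h. cmod c \<le> 1 \<Longrightarrow> norm h < \<rho> \<Longrightarrow>
        norm (E (c *\<^sub>C h) - c *\<^sub>C E h) \<le> K * cmod c * (norm h)\<^sup>2"
    and add: "\<And>h k. norm h + norm k < \<rho> \<Longrightarrow>
        norm (E (h + k) - E h - E k) \<le> K * (norm h + norm k)\<^sup>2"
    and bdd: "\<And>h. norm h < \<rho> \<Longrightarrow> norm (E h) \<le> L * norm h"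
  obtains A where "bounded_clinear A" "(E has_derivative A) (at 0)"
proof -
  define X where "X h n = (2 ^ n :: real) *\<^sub>R E ((1 / 2 ^ n :: real) *\<^sub>R h)" for h n
  have lim0: "(\<lambda>n. C / 2 ^ n) \<longlonglongrightarrow> 0" for C :: real
    using tendsto_mult[OF tendsto_const[of C] LIMSEQ_inverse_realpow_zero[of 2]] by (simp add: field_simps)
  have small: "\<forall>\<^sub>F n in sequentially. C / 2 ^ n < \<epsilon>" if "0 < \<epsilon>" for C \<epsilon> :: real
    using lim0 that by (rule order_tendstoD)
  have step: "norm (X h m - X h n) \<le> K * (norm h)\<^sup>2 / 2 ^ n" if mn: "n \<le> m" and h: "norm h / 2 ^ n < \<rho>" for h m n
  proof -
    \<comment> \<open>Both rescalings use points on one ray, with ratio \<open>c\<close>; thus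
      \<open>hom\<close> compares them.\<close>
    define c :: real where "c = 2 ^ n / 2 ^ m"
    have c: "0 < c" "c \<le> 1" using mn by (auto simp: c_def power_increasing)
    define k where "k = (1 / 2 ^ n :: real) *\<^sub>R h"
    have "norm k < \<rho>" using h by (simp add: k_def)
    from hom[of "complex_of_real c" k] c this
    have "norm (E (c *\<^sub>R k) - c *\<^sub>R E k) \<le> K * c * (norm k)\<^sup>2" by (simp add: scaleC_of_real)
    moreover have "X h m - X h n = (2 ^ m :: real) *\<^sub>R (E (c *\<^sub>R k) - c *\<^sub>R E k)"
      by (simp add: X_def k_def c_def scaleR_diff_right)
    ultimately have "norm (X h m - X h n) \<le> 2 ^ m * (K * c * (norm k)\<^sup>2)" by simp
    also have "\<dots> = K * (norm h)\<^sup>2 / 2 ^ n"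
      by (simp add: k_def c_def power_divide power2_eq_square)
    finally show ?thesis .
  qed
  have "Cauchy (X h)" for h
  proof (rule CauchyI)
    fix \<epsilon> :: real assume "0 < \<epsilon>"
    from eventually_conj[OF small[OF \<rho>, of "norm h"] small[OF half_gt_zero[OF \<open>0 < \<epsilon>\<close>], of "K * (norm h)\<^sup>2"]]
    obtain N where N: "norm h / 2 ^ N < \<rho>" "K * (norm h)\<^sup>2 / 2 ^ N < \<epsilon> / 2"
      unfolding eventually_sequentially by blast
    have "norm (X h m - X h n) < \<epsilon>" if "m \<ge> N" "n \<ge> N" for m n
    proof -
      have "norm (X h m - X h n) \<le> norm (X h m - X h N) + norm (X h n - X h N)"
        using norm_triangle_ineq4[of "X h m - X h N" "X h n - X h N"] by simp
      then show ?thesis using step[OF that(1) N(1)] step[OF that(2) N(1)] N(2) by linarith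
    qed
    then show "\<exists>N. \<forall>m\<ge>N. \<forall>n\<ge>N. norm (X h m - X h n) < \<epsilon>" by blast
  qed
  then have conv: "X h \<longlonglongrightarrow> lim (X h)" for h
    by (simp only: Cauchy_convergent_iff convergent_LIMSEQ_iff)
  define A where "A h = lim (X h)" for h
  note lim = conv[folded A_def]
  \<comment> \<open>Since \<open>X h 0 = E h\<close>, this is \<open>step\<close> with
    \<open>n = 0\<close> and \<open>m\<close> tending to infinity.\<close>
  have AE: "norm (A h - E h) \<le> K * (norm h)\<^sup>2" if "norm h < \<rho>" for h
  proof (rule tendsto_upperbound[where F=sequentially])
    show "(\<lambda>m. norm (X h m - E h)) \<longlonglongrightarrow> norm (A h - E h)" by (intro tendsto_intros lim)
    show "\<forall>\<^sub>F m in sequentially. norm (X h m - E h) \<le> K * (norm h)\<^sup>2"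
      using step[of 0 _ h] that by (simp add: X_def)
  qed simp
  have Aadd: "A (h + k) = A h + A k" for h k
  proof -
    have "(\<lambda>n. X (h + k) n - X h n - X k n) \<longlonglongrightarrow> 0"
    proof (rule Lim_null_comparison[OF _ lim0])
      show "\<forall>\<^sub>F n in sequentially. norm (X (h + k) n - X h n - X k n) \<le> K * (norm h + norm k)\<^sup>2 / 2 ^ n"
        using small[OF \<rho>, of "norm h + norm k"]
      proof eventually_elim
        case (elim n)
        let ?s = "1 / 2 ^ n :: real"
        have "X (h + k) n - X h n - X k n
            = (2 ^ n :: real) *\<^sub>R (E (?s *\<^sub>R h + ?s *\<^sub>R k) - E (?s *\<^sub>R h) - E (?s *\<^sub>R k))"
          by (simp add: X_def scaleR_diff_right scaleR_add_right)
        moreover have "norm (E (?s *\<^sub>R h + ?s *\<^sub>R k) - E (?s *\<^sub>R h) - E (?s *\<^sub>R k))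
            \<le> K * (norm (?s *\<^sub>R h) + norm (?s *\<^sub>R k))\<^sup>2"
          by (rule add) (use elim in \<open>simp add: add_divide_distrib\<close>)
        ultimately have "norm (X (h + k) n - X h n - X k n)
            \<le> 2 ^ n * (K * (norm (?s *\<^sub>R h) + norm (?s *\<^sub>R k))\<^sup>2)" by simp
        also have "\<dots> = K * (norm h + norm k)\<^sup>2 / 2 ^ n"
          by (simp add: power_divide power2_eq_square field_simps)
        finally show ?case .
      qed
    qed
    moreover have "(\<lambda>n. X (h + k) n - X h n - X k n) \<longlonglongrightarrow> A (h + k) - A h - A k"
      by (intro tendsto_intros lim)
    ultimately have "A (h + k) - A h - A k = 0" using LIMSEQ_unique by blast
    then show ?thesis by (simp add: algebra_simps)
  qed
  have Ahom1: "A (c *\<^sub>C h) = c *\<^sub>C A h" if c: "cmod c \<le> 1" for c h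
  proof -
    have "(\<lambda>n. X (c *\<^sub>C h) n - c *\<^sub>C X h n) \<longlonglongrightarrow> 0"
    proof (rule Lim_null_comparison[OF _ lim0])
      show "\<forall>\<^sub>F n in sequentially. norm (X (c *\<^sub>C h) n - c *\<^sub>C X h n) \<le> K * cmod c * (norm h)\<^sup>2 / 2 ^ n"
        using small[OF \<rho>, of "norm h"]
      proof eventually_elim
        case (elim n)
        let ?s = "1 / 2 ^ n :: real"
        have "X (c *\<^sub>C h) n - c *\<^sub>C X h n
            = (2 ^ n :: real) *\<^sub>R (E (c *\<^sub>C ?s *\<^sub>R h) - c *\<^sub>C E (?s *\<^sub>R h))"
          by (simp add: X_def scaleR_diff_right scaleC.scaleR_right)
        moreover have "norm (E (c *\<^sub>C ?s *\<^sub>R h) - c *\<^sub>C E (?s *\<^sub>R h)) \<le> K * cmod c * (norm (?s *\<^sub>R h))\<^sup>2"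
          by (rule hom[OF c]) (use elim in simp)
        ultimately have "norm (X (c *\<^sub>C h) n - c *\<^sub>C X h n) \<le> 2 ^ n * (K * cmod c * (norm (?s *\<^sub>R h))\<^sup>2)" by simp
        also have "\<dots> = K * cmod c * (norm h)\<^sup>2 / 2 ^ n"
          by (simp add: power_divide power2_eq_square field_simps)
        finally show ?case .
      qed
    qed
    moreover have "(\<lambda>n. X (c *\<^sub>C h) n - c *\<^sub>C X h n) \<longlonglongrightarrow> A (c *\<^sub>C h) - c *\<^sub>C A h"
      by (intro tendsto_intros lim bounded_linear.tendsto[OF scaleC.bounded_linear_right])
    ultimately have "A (c *\<^sub>C h) - c *\<^sub>C A h = 0" using LIMSEQ_unique by blast
    then show ?thesis by simp
  qed
  have Ahom: "A (c *\<^sub>C h) = c *\<^sub>C A h" for c h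
  proof (cases "cmod c \<le> 1")
    case False
    \<comment> \<open>For a scalar of modulus above 1 the case already settled is applied to its
      inverse.\<close>
    then have "c \<noteq> 0" "cmod (inverse c) \<le> 1" by (auto simp: norm_inverse inverse_le_1_iff)
    from Ahom1[OF this(2), of "c *\<^sub>C h"] \<open>c \<noteq> 0\<close> have "A h = inverse c *\<^sub>C A (c *\<^sub>C h)"
      by (simp add: scaleC_scaleC)
    with \<open>c \<noteq> 0\<close> show ?thesis by (simp add: scaleC_scaleC)
  qed (rule Ahom1)
  have Abdd: "norm (A h) \<le> norm h * L" for h
  proof (rule tendsto_upperbound[where F=sequentially])
    show "(\<lambda>n. norm (X h n)) \<longlonglongrightarrow> norm (A h)" by (intro tendsto_intros lim)
    show "\<forall>\<^sub>F n in sequentially. norm (X h n) \<le> norm h * L"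
      using small[OF \<rho>, of "norm h"]
    proof eventually_elim
      case (elim n)
      then show ?case
        using bdd[of "(1 / 2 ^ n :: real) *\<^sub>R h"] by (simp add: X_def field_simps)
    qed
  qed simp
  have blA: "bounded_linear A"
    by (rule bounded_linear_intro[OF Aadd _ Abdd]) (metis Ahom scaleC_of_real)
  have E0: "E 0 = 0" using bdd[of 0] \<rho> by simp
  have "(E has_derivative A) (at 0)"
    unfolding has_derivative_at
  proof (intro conjI blA, rule Lim_null_comparison)
    show "\<forall>\<^sub>F h in at 0. norm (norm (E (0 + h) - E 0 - A h) / norm h) \<le> K * norm h"
      unfolding eventually_at
    proof (intro exI[of _ \<rho>] conjI \<rho> ballI impI)
      fix h :: 'a assume "h \<noteq> 0 \<and> dist h 0 < \<rho>"
      then show "norm (norm (E (0 + h) - E 0 - A h) / norm h) \<le> K * norm h"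
        using AE[of h] by (simp add: E0 norm_minus_commute power2_eq_square field_simps)
    qed
    show "((\<lambda>h. K * norm h) \<longlongrightarrow> 0) (at 0)"
      by (rule tendsto_eq_intros refl)+ simp
  qed
  with blA Ahom show ?thesis by (intro that) (auto simp: bounded_clinear_def)
qed

text \<open>The first-order Taylor remainder of \<open>F\<close> is quadratic in the increment,
  uniformly in base points near \<open>z0\<close>. Second differences of \<open>F\<close> are
  combinations of such remainders, and the Cauchy estimate passes the quadratic bound to the
  corresponding combinations of \<open>fderiv F\<close>. Its increment at \<open>z0\<close> is
  therefore linear up to a quadratic error.\<close>

theorem frechet_holomorphic_on_fderiv:
  fixes F :: "'a::complex_normed_vector \<Rightarrow> 'b::complex_banach"
  assumes S: "open S" and F: "frechet_holomorphic_on F S"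
  shows "frechet_holomorphic_on (fderiv F) S"
  unfolding frechet_holomorphic_on_def
proof
  fix z0 assume "z0 \<in> S"
  define D where "D = fderiv F"
  have DF: "has_cderiv F (D z) z" if "z \<in> S" for z
    using F that by (simp add: frechet_holomorphic_on_iff D_def)
  define M where "M = norm (F z0) + 1"
  have "isCont F z0"
    using has_cderivD(1)[OF DF[OF \<open>z0 \<in> S\<close>]] by (rule has_derivative_continuous)
  then obtain d1 where d1: "0 < d1" "\<And>w. dist w z0 < d1 \<Longrightarrow> dist (F w) (F z0) < 1"
    unfolding continuous_at_eps_delta by (metis zero_less_one)
  obtain d2 where d2: "0 < d2" "ball z0 d2 \<subseteq> S"
    using S \<open>z0 \<in> S\<close> open_contains_ball by blast
  \<comment> \<open>The radius \<open>4 * r\<close> is spent in stages: \<open>F\<close> is bounded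
    within \<open>4 * r\<close>, its derivative within \<open>3 * r\<close>, the derivative is
    Lipschitz within \<open>2 * r\<close>, and the remainders are controlled for base points within
    \<open>r\<close>.\<close>
  define r where "r = min d1 d2 / 4"
  have r: "0 < r" using d1(1) d2(1) by (simp add: r_def)
  have M0: "0 \<le> M" by (simp add: M_def)
  have DF': "has_cderiv F (D w) w" if "dist z0 w < 4 * r" for w
    using that d2(2) by (intro DF) (auto simp: r_def)
  have FM: "norm (F w) \<le> M" if "dist z0 w < 4 * r" for w
  proof -
    have "dist (F w) (F z0) < 1" using that by (intro d1(2)) (simp add: r_def dist_commute)
    then show ?thesis using norm_triangle_sub[of "F w" "F z0"] by (simp add: M_def dist_norm)
  qed
  have D1: "norm (D w) \<le> M / r" if "dist z0 w < 3 * r" for w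
  proof (rule cauchy_estimate_frechet[OF r])
    fix x assume "x \<in> ball w r"
    then have "dist z0 x < 4 * r" using that dist_triangle[of z0 x w] by (simp add: dist_commute)
    then show "has_cderiv F (D x) x" "norm (F x) \<le> M" by (auto intro: DF' FM)
  qed
  have F1: "norm (F (w + h) - F w) \<le> M / r * norm h"
    if "dist z0 w < 3 * r" "dist z0 (w + h) < 3 * r" for w h
  proof -
    have "norm (F (w + h) - F w) \<le> M / r * norm ((w + h) - w)"
    proof (rule differentiable_bound[OF convex_ball[of z0 "3 * r"]])
      fix x assume x: "x \<in> ball z0 (3 * r)"
      then show "(F has_derivative D x) (at x within ball z0 (3 * r))"
        using r by (intro has_derivative_at_withinI[OF has_cderivD(1)[OF DF']]) auto
      show "onorm (D x) \<le> M / r"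
        unfolding norm_blinfun.rep_eq[symmetric] by (rule D1) (use x in simp)
    qed (use that in auto)
    then show ?thesis by simp
  qed
  define L where "L = M / r / r"
  have L0: "0 \<le> L" using M0 r by (simp add: L_def)
  have D2: "norm (D (w + h) - D w) \<le> L * norm h"
    if "dist z0 w < 2 * r" "dist z0 (w + h) < 2 * r" for w h
  proof -
    have "norm (D (w + h) - D w) \<le> (M / r * norm h) / r"
    proof (rule cauchy_estimate_frechet[OF r, where G="\<lambda>x. F (x + h) - F x"])
      fix x assume "x \<in> ball w r"
      then have x: "dist z0 x < 3 * r" "dist z0 (x + h) < 3 * r"
        using that dist_triangle[of z0 x w] dist_triangle[of z0 "x + h" "w + h"]
        by (simp_all add: dist_commute)
      then show "has_cderiv (\<lambda>x. F (x + h) - F x) (D (x + h) - D x) x"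
        using r by (intro has_cderiv_diff has_cderiv_shift DF') auto
      show "norm (F (x + h) - F x) \<le> M / r * norm h" using F1[OF x] .
    qed
    then show ?thesis by (simp add: L_def)
  qed
  define R where "R w h = F (w + h) - F w - D w h" for w h
  \<comment> \<open>Along the segment from \<open>w\<close> to \<open>w + h\<close> the derivative
    differs from \<open>D w\<close> by at most \<open>L * norm h\<close>, and the mean value
    inequality supplies the second factor \<open>norm h\<close>.\<close>
  have R: "norm (R w h) \<le> L * (norm h)\<^sup>2" if "dist z0 w < r" "norm h < r" for w h
  proof -
    have near: "dist z0 (w + t *\<^sub>R h) < 2 * r" if "t \<in> {0..1}" for t
    proof -
      have "t * norm h \<le> 1 * norm h" using that by (intro mult_right_mono) auto
      then show ?thesis using that \<open>dist z0 w < r\<close> \<open>norm h < r\<close> dist_triangle[of z0 "w + t *\<^sub>R h" w]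
        by (simp add: dist_norm)
    qed
    define T where "T = (\<lambda>t. w + t *\<^sub>R h) ` {0..1}"
    have "norm (F (w + h) - F w - D w ((w + h) - w)) \<le> norm ((w + h) - w) * (L * norm h)"
    proof (rule differentiable_bound_linearization[where S=T])
      show "w + t *\<^sub>R (w + h - w) \<in> T" if "t \<in> {0..1}" for t using that by (auto simp: T_def)
      show "w \<in> T" unfolding T_def by (rule image_eqI[of _ _ 0]) auto
      fix x assume "x \<in> T"
      then obtain t where t: "t \<in> {0..1}" "x = w + t *\<^sub>R h" by (auto simp: T_def)
      show "(F has_derivative D x) (at x within T)"
        using near[OF t(1)] r t(2) by (intro has_derivative_at_withinI[OF has_cderivD(1)[OF DF']]) auto
      have "norm (D x - D w) \<le> L * norm (t *\<^sub>R h)"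
        unfolding t(2) using near[OF t(1)] near[of 0] by (intro D2) auto
      also have "\<dots> \<le> L * norm h" using t(1) L0 by (intro mult_left_mono) (auto simp: mult_left_le_one_le)
      finally show "onorm (blinfun_apply (D x) - blinfun_apply (D w)) \<le> L * norm h"
        by (simp add: norm_blinfun.rep_eq minus_blinfun.rep_eq fun_diff_def)
    qed
    then show ?thesis by (simp add: R_def power2_eq_square mult_ac)
  qed
  define E where "E h = D (z0 + h) - D z0" for h
  have inb: "dist z0 (w + h) < 4 * r" if "w \<in> ball z0 r" "norm h < r" for w h
    using that r dist_triangle[of z0 "w + h" w] by (simp add: dist_norm)
  obtain A where A: "bounded_clinear A" "(E has_derivative A) (at 0)"
  proof (rule quasilinear_has_derivative[OF r, of "2 * L / r" E L])
    show "0 \<le> 2 * L / r" using L0 r by simp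
    show "norm (E h) \<le> L * norm h" if "norm h < r" for h
      unfolding E_def using that r by (intro D2) (auto simp: dist_norm)
  next
    fix h k :: 'a assume hk: "norm h + norm k < r"
    have hk': "norm h < r" "norm k < r" "norm (h + k) < r"
      using hk norm_ge_zero[of h] norm_ge_zero[of k] norm_triangle_ineq[of h k] by linarith+
    have "norm ((D (z0 + (h + k)) - D (z0 + h)) - (D (z0 + k) - D z0)) \<le> 2 * L * (norm h + norm k)\<^sup>2 / r"
    proof (rule cauchy_estimate_frechet[OF r, where G="\<lambda>w. (F (w + (h + k)) - F (w + h)) - (F (w + k) - F w)"])
      fix w assume w: "w \<in> ball z0 r"
      show "has_cderiv (\<lambda>w. (F (w + (h + k)) - F (w + h)) - (F (w + k) - F w))
          ((D (w + (h + k)) - D (w + h)) - (D (w + k) - D w)) w"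
        using hk' inb[OF w] w r by (intro has_cderiv_diff has_cderiv_shift DF') auto
      \<comment> \<open>The terms linear in \<open>D w\<close> cancel, leaving remainders only. The
        whole is bounded by twice \<open>L * (norm h + norm k)\<^sup>2\<close>; the Cauchy estimate
        then divides by \<open>r\<close>.\<close>
      have "(F (w + (h + k)) - F (w + h)) - (F (w + k) - F w) = R w (h + k) - R w h - R w k"
        by (simp add: R_def blinfun.add_right)
      also have "norm \<dots> \<le> norm (R w (h + k)) + norm (R w h) + norm (R w k)"
        by (meson norm_triangle_ineq4 add_mono order_trans order_refl)
      also have "\<dots> \<le> L * (norm (h + k))\<^sup>2 + L * (norm h)\<^sup>2 + L * (norm k)\<^sup>2"
        using w hk' by (intro add_mono R) auto
      also have "\<dots> \<le> L * (norm h + norm k)\<^sup>2 + L * ((norm h)\<^sup>2 + (norm k)\<^sup>2)"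
        using L0 norm_triangle_ineq[of h k] by (simp add: mult_left_mono power_mono distrib_left)
      also have "\<dots> \<le> L * (norm h + norm k)\<^sup>2 + L * (norm h + norm k)\<^sup>2"
        using L0 by (intro add_left_mono mult_left_mono) (auto simp: power2_sum)
      finally show "norm ((F (w + (h + k)) - F (w + h)) - (F (w + k) - F w)) \<le> 2 * L * (norm h + norm k)\<^sup>2"
        by simp
    qed
    then show "norm (E (h + k) - E h - E k) \<le> 2 * L / r * (norm h + norm k)\<^sup>2"
      by (simp add: E_def algebra_simps)
  next
    fix c and h :: 'a assume c: "cmod c \<le> 1" and h: "norm h < r"
    have ch: "norm (c *\<^sub>C h) < r"
      using c h mult_right_mono[OF c norm_ge_zero[of h]] by (simp add: norm_scaleC)
    have "norm ((D (z0 + c *\<^sub>C h) - D z0) - c *\<^sub>C (D (z0 + h) - D z0)) \<le> 2 * L * cmod c * (norm h)\<^sup>2 / r"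
    proof (rule cauchy_estimate_frechet[OF r, where G="\<lambda>w. (F (w + c *\<^sub>C h) - F w) - c *\<^sub>C (F (w + h) - F w)"])
      fix w assume w: "w \<in> ball z0 r"
      show "has_cderiv (\<lambda>w. (F (w + c *\<^sub>C h) - F w) - c *\<^sub>C (F (w + h) - F w))
          ((D (w + c *\<^sub>C h) - D w) - c *\<^sub>C (D (w + h) - D w)) w"
        using ch h inb[OF w] w r by (intro has_cderiv_diff has_cderiv_scaleC has_cderiv_shift DF') auto
      have "D w (c *\<^sub>C h) = c *\<^sub>C D w h"
        using w r by (intro has_cderivD(2)[OF DF']) auto
      then have "(F (w + c *\<^sub>C h) - F w) - c *\<^sub>C (F (w + h) - F w) = R w (c *\<^sub>C h) - c *\<^sub>C R w h"
        by (simp add: R_def scaleC.diff_right)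
      also have "norm \<dots> \<le> norm (R w (c *\<^sub>C h)) + cmod c * norm (R w h)"
        by (metis norm_scaleC norm_triangle_ineq4)
      also have "\<dots> \<le> L * (norm (c *\<^sub>C h))\<^sup>2 + cmod c * (L * (norm h)\<^sup>2)"
        using w h ch by (intro add_mono mult_left_mono R) auto
      also have "\<dots> = cmod c * cmod c * (L * (norm h)\<^sup>2) + cmod c * (L * (norm h)\<^sup>2)"
        by (simp add: norm_scaleC power2_eq_square)
      \<comment> \<open>One factor \<open>cmod c\<close> is replaced by 1 and the other kept,
        because the homogeneity defect must be linear in \<open>cmod c\<close>.\<close>
      also have "\<dots> \<le> cmod c * 1 * (L * (norm h)\<^sup>2) + cmod c * (L * (norm h)\<^sup>2)"
        using c L0 by (intro add_right_mono mult_right_mono mult_left_mono) auto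
      finally show "norm ((F (w + c *\<^sub>C h) - F w) - c *\<^sub>C (F (w + h) - F w)) \<le> 2 * L * cmod c * (norm h)\<^sup>2"
        by (simp add: mult_ac)
    qed
    then show "norm (E (c *\<^sub>C h) - c *\<^sub>C E h) \<le> 2 * L / r * cmod c * (norm h)\<^sup>2"
      by (simp add: E_def)
  qed
  have "((\<lambda>z. E (z - z0) + D z0) has_derivative A) (at z0)"
    by (rule has_derivative_eq_rhs, rule has_derivative_add,
        rule has_derivative_compose[of "\<lambda>z. z - z0" "\<lambda>h. h"])
       (use A(2) in \<open>auto intro!: derivative_eq_intros\<close>)
  moreover have "(\<lambda>z. E (z - z0) + D z0) = D" by (simp add: E_def fun_eq_iff)
  ultimately show "\<exists>A. bounded_clinear A \<and> (fderiv F has_derivative A) (at z0)"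
    using A(1) by (auto simp: D_def)
qed

section \<open>Starlike functions of the unit disc\<close>

lemma cmod_coeff_le_of_cmod_le_1:
  assumes hol: "g holomorphic_on ball 0 1" and b: "\<And>\<zeta>. cmod \<zeta> < 1 \<Longrightarrow> cmod (g \<zeta>) \<le> 1"
  shows "cmod (fps_nth (fps_expansion g 0) n) \<le> 1"
proof -
  let ?a = "cmod (fps_nth (fps_expansion g 0) n)"
  have "?a * s ^ n \<le> 1" if s: "0 < s" "s < 1" for s
  proof -
    have "cmod ((deriv ^^ n) g 0) \<le> fact n * 1 / s ^ n"
    proof (rule Cauchy_inequality)
      show "g holomorphic_on ball 0 s"
        using hol by (rule holomorphic_on_subset) (use s in auto)
      show "continuous_on (cball 0 s) g"
        by (rule continuous_on_subset[OF holomorphic_on_imp_continuous_on[OF hol]]) (use s in auto)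
    qed (use s b in auto)
    then show ?thesis using s by (simp add: fps_expansion_def norm_divide field_simps)
  qed
  moreover have "((\<lambda>s. ?a * s ^ n) \<longlongrightarrow> ?a * 1 ^ n) (at_left 1)"
    by (intro tendsto_intros)
  moreover have "\<forall>\<^sub>F s in at_left (1::real). 0 < s \<and> s < 1"
    using eventually_at_left_real[OF zero_less_one] by eventually_elim auto
  ultimately show ?thesis
    by (intro tendsto_upperbound[of "\<lambda>s. ?a * s ^ n" ?a "at_left 1"])
       (auto elim: eventually_mono)
qed

lemma has_fps_expansion_ball:
  "g holomorphic_on ball 0 1 \<Longrightarrow> g has_fps_expansion fps_expansion g (0::complex)"
  by (rule has_fps_expansion_fps_expansion[of "ball 0 1"]) auto

lemma has_fps_expansion_unique_ball:
  fixes f g :: "complex \<Rightarrow> complex"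
  assumes "f has_fps_expansion F" "g has_fps_expansion G" "\<And>\<zeta>. cmod \<zeta> < 1 \<Longrightarrow> f \<zeta> = g \<zeta>"
  shows "F = G"
proof -
  have "\<forall>\<^sub>F \<zeta> in nhds 0. f \<zeta> = g \<zeta>"
    using eventually_nhds_in_open[OF open_ball, of "0::complex" 0 1, simplified]
    by eventually_elim (use assms(3) in auto)
  with assms(1) have "g has_fps_expansion F"
    using has_fps_expansion_cong by blast
  then show ?thesis using assms(2) fps_expansion_unique_complex by blast
qed

text \<open>The disc automorphism taking \<open>\<phi> 0\<close> to 0 turns \<open>\<phi>\<close>
  into a function \<open>g\<close> bounded by 1. Vanishing intermediate coefficients carry over to
  \<open>g\<close>, so its coefficient \<open>n\<close> is that of \<open>\<phi>\<close> divided by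
  \<open>1 - (cmod (\<phi> 0))\<^sup>2\<close>, and it is at most 1 in modulus.\<close>

lemma schwarz_pick_coeff:
  assumes hol: "\<phi> holomorphic_on ball 0 1" and b: "\<And>\<zeta>. cmod \<zeta> < 1 \<Longrightarrow> cmod (\<phi> \<zeta>) < 1"
    and n: "n \<noteq> 0" and gap: "\<And>i. 0 < i \<Longrightarrow> i < n \<Longrightarrow> fps_nth (fps_expansion \<phi> 0) i = 0"
  shows "cmod (fps_nth (fps_expansion \<phi> 0) n) \<le> 1 - (cmod (fps_nth (fps_expansion \<phi> 0) 0))\<^sup>2"
proof -
  define P where "P = fps_expansion \<phi> 0"
  define c where "c = fps_nth P 0"
  have c: "\<phi> 0 = c" by (simp add: c_def P_def fps_expansion_def)
  have c1: "cmod c < 1" using b[of 0] c by simp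
  have nz: "1 - cnj c * \<phi> \<zeta> \<noteq> 0" if "cmod \<zeta> < 1" for \<zeta>
  proof
    assume "1 - cnj c * \<phi> \<zeta> = 0"
    then have "cmod (cnj c * \<phi> \<zeta>) = 1" by simp
    then have "cmod c * cmod (\<phi> \<zeta>) = 1" by (simp add: norm_mult)
    moreover have "cmod c * cmod (\<phi> \<zeta>) \<le> cmod c" using b[OF that] by (intro mult_left_le) auto
    ultimately show False using c1 by simp
  qed
  define g where "g \<zeta> = (\<phi> \<zeta> - c) / (1 - cnj c * \<phi> \<zeta>)" for \<zeta>
  have g: "g holomorphic_on ball 0 1"
    unfolding g_def using nz by (intro holomorphic_intros hol) auto
  have gb: "cmod (g \<zeta>) \<le> 1" if "cmod \<zeta> < 1" for \<zeta>
  proof -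
    let ?w = "\<phi> \<zeta>"
    have "(cmod (1 - cnj c * ?w))\<^sup>2 - (cmod (?w - c))\<^sup>2 = (1 - (cmod c)\<^sup>2) * (1 - (cmod ?w)\<^sup>2)"
      by (simp only: cmod_power2) (simp add: power2_eq_square algebra_simps)
    moreover have "0 \<le> (1 - (cmod c)\<^sup>2) * (1 - (cmod ?w)\<^sup>2)"
      using c1 b[OF that] by (intro mult_nonneg_nonneg) (auto simp: power_le_one)
    ultimately have "(cmod (?w - c))\<^sup>2 \<le> (cmod (1 - cnj c * ?w))\<^sup>2" by linarith
    then have "cmod (?w - c) \<le> cmod (1 - cnj c * ?w)" by (rule power2_le_imp_le) simp
    then show ?thesis using nz[OF that] by (simp add: g_def norm_divide)
  qed
  define G where "G = fps_expansion g 0"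
  have "(\<lambda>\<zeta>. g \<zeta> * (1 - cnj c * \<phi> \<zeta>)) has_fps_expansion G * (1 - fps_const (cnj c) * P)"
    unfolding G_def P_def by (intro fps_expansion_intros has_fps_expansion_ball g hol)
  moreover have "(\<lambda>\<zeta>. \<phi> \<zeta> - c) has_fps_expansion P - fps_const c"
    unfolding P_def by (intro fps_expansion_intros has_fps_expansion_ball hol)
  ultimately have eq: "G * (1 - fps_const (cnj c) * P) = P - fps_const c"
    by (rule has_fps_expansion_unique_ball) (use nz in \<open>auto simp: g_def\<close>)
  have G0: "fps_nth G 0 = 0" by (simp add: G_def fps_expansion_def g_def c)
  have gapG: "fps_nth G i = 0" if "i < n" for i
    using that
  proof (induction i rule: less_induct)
    case (less i)
    show ?case
    proof (cases "i = 0")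
      case False
      have "fps_nth (G * (1 - fps_const (cnj c) * P)) i
          = fps_nth G i * (1 - cnj c * c)"
        unfolding fps_mult_nth using less
        by (subst sum.remove[of _ i]) (auto simp: c_def intro!: sum.neutral)
      moreover have "fps_nth (P - fps_const c) i = 0"
        using gap[of i] less False by (simp add: P_def)
      moreover have "1 - cnj c * c \<noteq> 0"
        using nz[of 0] c by simp
      ultimately show ?thesis using eq by simp
    qed (simp add: G0)
  qed
  have "fps_nth (G * (1 - fps_const (cnj c) * P)) n = fps_nth G n * (1 - cnj c * c)"
    unfolding fps_mult_nth using gapG
    by (subst sum.remove[of _ n]) (auto simp: c_def intro!: sum.neutral)
  then have "fps_nth P n = fps_nth G n * (1 - cnj c * c)"
    using eq n by simp
  moreover have "1 - cnj c * c = complex_of_real (1 - (cmod c)\<^sup>2)"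
    using complex_norm_square[of c] by (simp add: mult.commute)
  ultimately have "cmod (fps_nth P n) = cmod (fps_nth G n) * (1 - (cmod c)\<^sup>2)"
    using c1 by (simp only: norm_mult norm_of_real) (simp add: power_le_one)
  also have "\<dots> \<le> 1 * (1 - (cmod c)\<^sup>2)"
    unfolding G_def using c1
    by (intro mult_right_mono cmod_coeff_le_of_cmod_le_1 g gb) (auto simp: power_le_one)
  finally show ?thesis by (simp add: P_def c_def)
qed

text \<open>Averaging over \<open>\<zeta>\<close> and \<open>-\<zeta>\<close> removes the linear coefficient.\<close>
lemma schwarz_pick_coeff_1_2:
  assumes hol: "\<phi> holomorphic_on ball 0 1" and b: "\<And>\<zeta>. cmod \<zeta> < 1 \<Longrightarrow> cmod (\<phi> \<zeta>) < 1"
  defines "P \<equiv> fps_expansion \<phi> 0"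
  shows "cmod (fps_nth P 1) \<le> 1 - (cmod (fps_nth P 0))\<^sup>2"
    and "cmod (fps_nth P 2) \<le> 1 - (cmod (fps_nth P 0))\<^sup>2"
proof -
  show "cmod (fps_nth P 1) \<le> 1 - (cmod (fps_nth P 0))\<^sup>2"
    unfolding P_def by (rule schwarz_pick_coeff[OF hol b]) auto
  define \<psi> where "\<psi> \<zeta> = (\<phi> \<zeta> + \<phi> (- \<zeta>)) / 2" for \<zeta>
  have holm: "(\<lambda>\<zeta>. \<phi> (- \<zeta>)) holomorphic_on ball 0 1"
    by (rule holomorphic_on_compose_gen[of uminus _ \<phi> "ball 0 1", unfolded o_def])
       (auto intro!: holomorphic_intros hol)
  have \<psi>: "\<psi> holomorphic_on ball 0 1"
    unfolding \<psi>_def by (intro holomorphic_intros hol holm) auto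
  have \<psi>b: "cmod (\<psi> \<zeta>) < 1" if "cmod \<zeta> < 1" for \<zeta>
    using norm_triangle_ineq[of "\<phi> \<zeta>" "\<phi> (- \<zeta>)"] b[of \<zeta>] b[of "- \<zeta>"] that
    by (simp add: \<psi>_def norm_divide)
  have "(\<lambda>\<zeta>. \<phi> (- \<zeta>)) has_fps_expansion fps_compose P (- fps_X)"
    unfolding P_def
    by (rule has_fps_expansion_compose[of \<phi> _ uminus, unfolded o_def])
       (auto intro!: fps_expansion_intros has_fps_expansion_ball hol)
  then have "(\<lambda>\<zeta>. (\<phi> \<zeta> + \<phi> (- \<zeta>)) * (1 / 2)) has_fps_expansion (P + fps_compose P (- fps_X)) * fps_const (1 / 2)"
    unfolding P_def by (intro fps_expansion_intros has_fps_expansion_ball hol)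
  moreover have "(\<lambda>\<zeta>. (\<phi> \<zeta> + \<phi> (- \<zeta>)) * (1 / 2)) = \<psi>" by (simp add: \<psi>_def fun_eq_iff)
  ultimately have "\<psi> has_fps_expansion (P + fps_compose P (- fps_X)) * fps_const (1 / 2)" by simp
  from fps_expansion_unique_complex[OF has_fps_expansion_ball[OF \<psi>] this]
  have Q: "fps_expansion \<psi> 0 = (P + fps_compose P (- fps_X)) * fps_const (1 / 2)" .
  have Qn: "fps_nth (fps_expansion \<psi> 0) i = (1 + (- 1) ^ i) * fps_nth P i / 2" for i
    by (simp add: Q fps_compose_uminus' algebra_simps)
  have "cmod (fps_nth (fps_expansion \<psi> 0) 2) \<le> 1 - (cmod (fps_nth (fps_expansion \<psi> 0) 0))\<^sup>2"
  proof (rule schwarz_pick_coeff[OF \<psi> \<psi>b])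
    fix i :: nat assume "0 < i" "i < 2"
    then have "i = 1" by simp
    then show "fps_nth (fps_expansion \<psi> 0) i = 0" by (simp add: Qn)
  qed auto
  then show "cmod (fps_nth P 2) \<le> 1 - (cmod (fps_nth P 0))\<^sup>2"
    by (simp add: Qn)
qed

lemma schwarz_coeff_combination:
  fixes c0 c1 c2 :: complex
  assumes "cmod c1 \<le> 1 - (cmod c0)\<^sup>2" "cmod c2 \<le> 1 - (cmod c0)\<^sup>2"
  shows "cmod (3 * c0 ^ 3 - 2 * c0 * c1 - c2) \<le> 3"
proof -
  define x where "x = cmod c0"
  have x: "0 \<le> x" by (simp add: x_def)
  have "0 \<le> 1 - x\<^sup>2" using order_trans[OF norm_ge_zero assms(1)] by (simp add: x_def)
  then have "x \<le> 1" using x abs_square_le_1[of x] by simp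
  have "cmod (3 * c0 ^ 3 - 2 * c0 * c1 - c2) \<le> cmod (3 * c0 ^ 3) + cmod (2 * c0 * c1) + cmod c2"
    by (meson norm_triangle_ineq4 add_mono order_trans order_refl)
  also have "\<dots> = 3 * x ^ 3 + 2 * x * cmod c1 + cmod c2"
    by (simp add: norm_mult norm_power x_def)
  also have "\<dots> \<le> 3 * x ^ 3 + 2 * x * (1 - x\<^sup>2) + (1 - x\<^sup>2)"
    using assms x by (intro add_mono mult_left_mono) (auto simp: x_def)
  \<comment> \<open>The cubic bound reaches 3 at \<open>x = 1\<close>; the factorisation shows that
    it stays below on the unit interval.\<close>
  also have "\<dots> = 3 - (1 - x) * (x\<^sup>2 + 2)"
    by (simp add: power2_eq_square power3_eq_cube algebra_simps)
  also have "\<dots> \<le> 3" using \<open>x \<le> 1\<close> by simp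
  finally show ?thesis .
qed

text \<open>Here \<open>k\<close> stands for \<open>h \<zeta> / \<zeta>\<close> with
  \<open>h\<close> starlike, and \<open>star\<close> is the condition on
  \<open>h / (\<zeta> h')\<close>. Indices are shifted by one: \<open>a n\<close> is the coefficient
  of \<open>h\<close> at degree \<open>n + 1\<close>.\<close>

theorem starlike_coefficient_bound:
  assumes k: "k holomorphic_on ball 0 1" and k0: "k 0 = 1"
    and star: "\<And>\<zeta>. cmod \<zeta> < 1 \<Longrightarrow> 0 < Re (k \<zeta> / (k \<zeta> + \<zeta> * deriv k \<zeta>))"
  defines "a \<equiv> fps_nth (fps_expansion k 0)"
  shows "cmod (a 1 * a 2 - a 3) \<le> 2"
proof -
  have k': "deriv k holomorphic_on ball 0 1"
    by (rule holomorphic_deriv[OF k]) auto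
  text \<open>The Cayley transform of \<open>k / (k + \<zeta> k')\<close> is \<open>\<zeta> k' / (2 k + \<zeta> k')\<close>.\<close>
  have cay: "cmod (\<zeta> * deriv k \<zeta>) < cmod (2 * k \<zeta> + \<zeta> * deriv k \<zeta>)" if "cmod \<zeta> < 1" for \<zeta>
  proof -
    define u v where "u = k \<zeta>" and "v = k \<zeta> + \<zeta> * deriv k \<zeta>"
    have pos: "0 < Re (u / v)" using star[OF that] by (simp add: u_def v_def)
    then have "v \<noteq> 0" by auto
    have "cmod (v - u) < cmod (v + u)"
    proof -
      have "0 < (cmod v)\<^sup>2 * Re (u / v)" using pos \<open>v \<noteq> 0\<close> by simp
      also have "\<dots> = Re (u * cnj v)"
        using \<open>v \<noteq> 0\<close> by (simp add: Re_divide' cmod_power2)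
      finally have "(cmod (v - u))\<^sup>2 < (cmod (v + u))\<^sup>2"
        by (simp only: cmod_power2) (simp add: power2_eq_square algebra_simps)
      then show ?thesis by (rule power2_less_imp_less) simp
    qed
    then show ?thesis by (simp add: u_def v_def add.commute)
  qed
  then have nz: "2 * k \<zeta> + \<zeta> * deriv k \<zeta> \<noteq> 0" if "cmod \<zeta> < 1" for \<zeta>
    using that by fastforce
  \<comment> \<open>The factor \<open>\<zeta>\<close> of the Cayley transform is dropped from the
    numerator, so the quotient by \<open>\<zeta>\<close> is holomorphic at 0 from the start.\<close>
  define \<phi> where "\<phi> \<zeta> = deriv k \<zeta> / (2 * k \<zeta> + \<zeta> * deriv k \<zeta>)" for \<zeta>
  have \<phi>: "\<phi> holomorphic_on ball 0 1"
    unfolding \<phi>_def using nz by (intro holomorphic_intros k k') auto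
  have \<omega>b: "cmod (\<zeta> * \<phi> \<zeta>) < 1" if "cmod \<zeta> < 1" for \<zeta>
    using cay[OF that] nz[OF that] by (simp add: \<phi>_def norm_divide norm_mult)
  have \<phi>1: "cmod (\<phi> \<zeta>) \<le> 1" if "cmod \<zeta> < 1" for \<zeta>
  proof -
    have \<omega>: "(\<lambda>\<zeta>. \<zeta> * \<phi> \<zeta>) holomorphic_on ball 0 1" by (intro holomorphic_intros \<phi>)
    have "((\<lambda>\<zeta>. \<zeta> * \<phi> \<zeta>) has_field_derivative \<phi> 0) (at 0)"
      using \<phi> by (auto intro!: derivative_eq_intros holomorphic_derivI[of \<phi> "ball 0 1"])
    then have "deriv (\<lambda>\<zeta>. \<zeta> * \<phi> \<zeta>) 0 = \<phi> 0" by (rule DERIV_imp_deriv)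
    with Schwarz_Lemma(1,2)[OF \<omega> _ \<omega>b that] show ?thesis
      by (cases "\<zeta> = 0") (auto simp: norm_mult)
  qed
  define P where "P = fps_expansion \<phi> 0"
  define K where "K = fps_expansion k 0"
  have "(\<lambda>\<zeta>. \<phi> \<zeta> * (2 * k \<zeta> + \<zeta> * deriv k \<zeta>)) has_fps_expansion P * (fps_const 2 * K + fps_X * fps_deriv K)"
    unfolding P_def K_def by (intro fps_expansion_intros has_fps_expansion_ball k \<phi>)
  moreover have "deriv k has_fps_expansion fps_deriv K"
    unfolding K_def by (intro fps_expansion_intros has_fps_expansion_ball k)
  \<comment> \<open>Clearing the denominator gives a recursion for the coefficients of
    \<open>k\<close> in terms of those of \<open>\<phi>\<close>; degrees 0, 1 and 2 are the ones
    read off.\<close>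
  ultimately have eq: "P * (fps_const 2 * K + fps_X * fps_deriv K) = fps_deriv K"
    by (rule has_fps_expansion_unique_ball) (use nz in \<open>auto simp: \<phi>_def\<close>)
  have K0: "fps_nth K 0 = 1" by (simp add: K_def fps_expansion_def k0)
  define c where "c = fps_nth P"
  have e: "fps_nth (P * (fps_const 2 * K + fps_X * fps_deriv K)) n = fps_nth (fps_deriv K) n" for n
    by (simp add: eq)
  have a1: "a 1 = 2 * c 0"
    using e[of 0] by (simp add: a_def c_def K0 mult.commute flip: K_def)
  have a2: "2 * a 2 = 2 * c 1 + 3 * a 1 * c 0"
    using e[of 1] by (simp add: fps_mult_nth a_def c_def K0 numeral_2_eq_2 flip: K_def) (simp add: algebra_simps)
  have a3: "3 * a 3 = 2 * c 2 + 3 * a 1 * c 1 + 4 * a 2 * c 0"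
    using e[of 2] by (simp add: fps_mult_nth a_def c_def K0 numeral_2_eq_2 numeral_3_eq_3 flip: K_def)
      (simp add: algebra_simps)
  have id: "a 1 * a 2 - a 3 = 2 / 3 * (3 * c 0 ^ 3 - 2 * c 0 * c 1 - c 2)"
  proof -
    have "2 * a 2 = 2 * (c 1 + 3 * c 0 ^ 2)"
      unfolding a2 a1 by (simp add: power2_eq_square algebra_simps)
    then have a2': "a 2 = c 1 + 3 * c 0 ^ 2" by (simp only: mult_cancel_left) simp
    have "3 * (a 1 * a 2 - a 3) = 2 * (3 * c 0 ^ 3 - 2 * c 0 * c 1 - c 2)"
      unfolding right_diff_distrib a3 unfolding a2' a1
      by (simp add: power2_eq_square power3_eq_cube algebra_simps)
    then show ?thesis by (simp add: field_simps)
  qed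
  have "cmod (c 1) \<le> 1 - (cmod (c 0))\<^sup>2 \<and> cmod (c 2) \<le> 1 - (cmod (c 0))\<^sup>2"
  \<comment> \<open>The Schwarz-Pick bounds assume strict inequality. If it fails, the maximum
    principle makes \<open>\<phi>\<close> a unimodular constant, and both bounds become
    \<open>0 \<le> 0\<close>.\<close>
  proof (cases "\<forall>\<zeta>\<in>ball 0 1. cmod (\<phi> \<zeta>) < 1")
    case True
    then show ?thesis
      using schwarz_pick_coeff_1_2[OF \<phi>] by (simp add: c_def P_def)
  next
    case False
    then obtain \<xi> where \<xi>: "\<xi> \<in> ball 0 1" "cmod (\<phi> \<xi>) = 1"
      using \<phi>1 by force
    then have "\<phi> constant_on ball 0 1"
      using \<phi>1 by (intro maximum_modulus_principle[OF \<phi>, of "ball 0 1" \<xi>]) auto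
    then obtain d where d: "\<And>\<zeta>. \<zeta> \<in> ball 0 1 \<Longrightarrow> \<phi> \<zeta> = d" by (auto simp: constant_on_def)
    with \<xi> have "cmod d = 1" by auto
    have "P = fps_const d"
      unfolding P_def
      by (rule has_fps_expansion_unique_ball[OF has_fps_expansion_ball[OF \<phi>] has_fps_expansion_const]) (use d in auto)
    then show ?thesis using \<open>cmod d = 1\<close> by (simp add: c_def)
  qed
  then have "cmod (3 * c 0 ^ 3 - 2 * c 0 * c 1 - c 2) \<le> 3"
    using schwarz_coeff_combination by blast
  then show ?thesis unfolding id norm_mult by simp
qed

section \<open>Starlike mappings of the form \<open>f z *\<^sub>C z\<close>\<close>

lemma support_functionalsD:
  assumes "l \<in> support_functionals z"
  shows "bounded_clinear l" "l z = complex_of_real (norm z)" "cmod (l x) \<le> norm x"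
proof -
  show l: "bounded_clinear l" and "l z = complex_of_real (norm z)"
    using assms by (auto simp: support_functionals_def)
  show "cmod (l x) \<le> norm x"
    using onorm[OF bounded_clinearD(1)[OF l], of x] assms by (simp add: support_functionals_def)
qed

lemma has_derivative_scaleC_self:
  assumes "(f has_derivative f') (at z)"
  shows "((\<lambda>z. f z *\<^sub>C z) has_derivative (\<lambda>v. f z *\<^sub>C v + f' v *\<^sub>C z)) (at z)"
  using scaleC.FDERIV[OF assms has_derivative_ident] .

lemma fderiv_scaleC_self:
  assumes f: "has_cderiv f T z" and F: "\<And>z. z \<in> ball 0 1 \<Longrightarrow> F z = f z *\<^sub>C z" and z: "z \<in> ball 0 1"
  shows "has_cderiv F (fderiv F z) z" and "fderiv F z v = f z *\<^sub>C v + T v *\<^sub>C z"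
proof -
  have "(F has_derivative (\<lambda>v. f z *\<^sub>C v + T v *\<^sub>C z)) (at z)"
    by (rule has_derivative_transform_within_open[OF has_derivative_scaleC_self[OF has_cderivD(1)[OF f]] open_ball z])
       (simp add: F)
  note * = this fderiv_eqI[OF this]
  then show "fderiv F z v = f z *\<^sub>C v + T v *\<^sub>C z" by simp
  show "has_cderiv F (fderiv F z) z"
    unfolding has_cderiv_def *(2)
    using * has_cderivD(2)[OF f] by (auto simp: scaleC_add_right scaleC_scaleC mult.commute)
qed

lemma scaleC_unit_in_ball: "norm w = 1 \<Longrightarrow> cmod \<zeta> < 1 \<Longrightarrow> \<zeta> *\<^sub>C w \<in> ball 0 1"
  by (simp add: norm_scaleC)

text \<open>The functional \<open>ev\<close> makes the lemma iterable: evaluating an operator at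
  \<open>w\<close> and then applying \<open>ev\<close> is again bounded linear, and
  \<open>deriv h\<close> takes over the role of \<open>h\<close>.\<close>

lemma fderiv_along_line:
  assumes w: "norm w = 1" and T: "frechet_holomorphic_on T (ball 0 1)"
    and ev: "bounded_linear ev" and h: "h holomorphic_on ball 0 1"
    and eq: "\<And>\<zeta>. cmod \<zeta> < 1 \<Longrightarrow> ev (T (\<zeta> *\<^sub>C w)) = h \<zeta>" and \<zeta>: "cmod \<zeta> < 1"
  shows "ev (fderiv T (\<zeta> *\<^sub>C w) w) = deriv h \<zeta>"
proof -
  have T': "has_cderiv T (fderiv T (\<zeta> *\<^sub>C w)) (\<zeta> *\<^sub>C w)"
    using T scaleC_unit_in_ball[OF w \<zeta>] by (simp add: frechet_holomorphic_on_iff)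
  have "((\<lambda>\<zeta>. T (\<zeta> *\<^sub>C w)) has_derivative (\<lambda>x. fderiv T (\<zeta> *\<^sub>C w) (x *\<^sub>C w))) (at \<zeta>)"
    by (rule has_derivative_compose[of "\<lambda>\<zeta>. \<zeta> *\<^sub>C w" "\<lambda>x. x *\<^sub>C w"])
       (auto intro: bounded_linear_imp_has_derivative scaleC.bounded_linear_left has_cderivD(1)[OF T'])
  then have "((\<lambda>\<zeta>. ev (T (\<zeta> *\<^sub>C w))) has_derivative (\<lambda>x. ev (fderiv T (\<zeta> *\<^sub>C w) (x *\<^sub>C w)))) (at \<zeta>)"
    by (rule bounded_linear.has_derivative[OF ev])
  then have 1: "(h has_derivative (\<lambda>x. ev (fderiv T (\<zeta> *\<^sub>C w) (x *\<^sub>C w)))) (at \<zeta>)"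
    by (rule has_derivative_transform_within_open[of _ _ _ _ "ball 0 1"]) (use \<zeta> eq in auto)
  have "(h has_field_derivative deriv h \<zeta>) (at \<zeta>)"
    using \<zeta> by (intro holomorphic_derivI[OF h]) auto
  then have "(h has_derivative (*) (deriv h \<zeta>)) (at \<zeta>)"
    by (simp only: has_field_derivative_def)
  from has_derivative_unique[OF 1 this] have "ev (fderiv T (\<zeta> *\<^sub>C w) (1 *\<^sub>C w)) = deriv h \<zeta> * 1"
    by (rule fun_cong)
  then show ?thesis by simp
qed

lemma holomorphic_on_slice:
  assumes w: "norm w = 1" and f: "frechet_holomorphic_on f (ball 0 1)"
  shows "(\<lambda>\<zeta>. f (\<zeta> *\<^sub>C w)) holomorphic_on ball (0::complex) 1"
  unfolding holomorphic_on_open[OF open_ball]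
proof
  fix \<zeta> :: complex assume "\<zeta> \<in> ball 0 1"
  then have "\<zeta> *\<^sub>C w \<in> ball 0 1" using scaleC_unit_in_ball[OF w] by simp
  then have T: "has_cderiv f (fderiv f (\<zeta> *\<^sub>C w)) (\<zeta> *\<^sub>C w)"
    using f by (simp add: frechet_holomorphic_on_iff)
  have "((\<lambda>\<zeta>. f (\<zeta> *\<^sub>C w)) has_derivative (\<lambda>x. fderiv f (\<zeta> *\<^sub>C w) (x *\<^sub>C w))) (at \<zeta>)"
    by (rule has_derivative_compose[of "\<lambda>\<zeta>. \<zeta> *\<^sub>C w" "\<lambda>x. x *\<^sub>C w"])
       (auto intro: bounded_linear_imp_has_derivative scaleC.bounded_linear_left has_cderivD(1)[OF T])
  moreover have "(\<lambda>x. fderiv f (\<zeta> *\<^sub>C w) (x *\<^sub>C w)) = (*) (fderiv f (\<zeta> *\<^sub>C w) w)"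
    by (rule ext) (simp add: has_cderivD(2)[OF T] mult.commute)
  ultimately show "\<exists>f'. ((\<lambda>\<zeta>. f (\<zeta> *\<^sub>C w)) has_field_derivative f') (at \<zeta>)"
    by (auto simp: has_field_derivative_def)
qed

lemma fderiv_scaleC_self_coeffs:
  fixes f :: "'a::complex_banach \<Rightarrow> complex" and F :: "'a \<Rightarrow> 'a"
  assumes f: "frechet_holomorphic_on f (ball 0 1)"
    and F: "\<forall>z\<in>ball 0 1. F z = f z *\<^sub>C z"
    and w: "norm w = 1" and l: "l \<in> support_functionals w"
  defines "a \<equiv> fps_nth (fps_expansion (\<lambda>\<zeta>. f (\<zeta> *\<^sub>C w)) 0)"
  shows "l (fderiv (fderiv F) 0 w w) = fact 2 * a 1"
    and "l (fderiv (fderiv (fderiv F)) 0 w w w) = fact 3 * a 2"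
    and "l (fderiv (fderiv (fderiv (fderiv F))) 0 w w w w) = fact 4 * a 3"
proof -
  have H0: "frechet_holomorphic_on F (ball 0 1)"
    unfolding frechet_holomorphic_on_iff
  proof
    fix z :: 'a assume z: "z \<in> ball 0 1"
    then show "has_cderiv F (fderiv F z) z"
      using f by (intro fderiv_scaleC_self(1)[OF _ F[rule_format]]) (auto simp: frechet_holomorphic_on_iff)
  qed
  note H1 = frechet_holomorphic_on_fderiv[OF open_ball H0]
  note H2 = frechet_holomorphic_on_fderiv[OF open_ball H1]
  note H3 = frechet_holomorphic_on_fderiv[OF open_ball H2]
  define h where "h \<zeta> = \<zeta> * f (\<zeta> *\<^sub>C w)" for \<zeta>
  have k: "(\<lambda>\<zeta>. f (\<zeta> *\<^sub>C w)) holomorphic_on ball 0 1"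
    by (rule holomorphic_on_slice[OF w f])
  have h0: "h holomorphic_on ball 0 1"
    unfolding h_def by (intro holomorphic_intros k)
  note h1 = holomorphic_deriv[OF h0 open_ball]
  note h2 = holomorphic_deriv[OF h1 open_ball]
  note h3 = holomorphic_deriv[OF h2 open_ball]
  have lb: "bounded_linear l" and lC: "l (c *\<^sub>C x) = c * l x" and lw: "l w = 1" for c x
    using bounded_clinearD[OF support_functionalsD(1)[OF l]] support_functionalsD(2)[OF l] w by auto
  have ev: "bounded_linear (\<lambda>T. e (blinfun_apply T w))" if "bounded_linear e" for e :: "'c::real_normed_vector \<Rightarrow> complex"
    by (rule bounded_linear_compose[OF that blinfun.bounded_linear_left])
  note e1 = ev[OF lb] note e2 = ev[OF e1] note e3 = ev[OF e2]
  have d0: "l (F (\<zeta> *\<^sub>C w)) = h \<zeta>" if "cmod \<zeta> < 1" for \<zeta>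
    using F[rule_format, OF scaleC_unit_in_ball[OF w that]] by (simp add: lC lw h_def)
  note d1 = fderiv_along_line[OF w H0 lb h0 d0]
  note d2 = fderiv_along_line[OF w H1 e1 h1 d1]
  note d3 = fderiv_along_line[OF w H2 e2 h2 d2]
  note d4 = fderiv_along_line[OF w H3 e3 h3 d3]
  have "h has_fps_expansion fps_X * fps_expansion (\<lambda>\<zeta>. f (\<zeta> *\<^sub>C w)) 0"
    unfolding h_def by (intro fps_expansion_intros has_fps_expansion_ball k)
  then have "fps_expansion h 0 = fps_X * fps_expansion (\<lambda>\<zeta>. f (\<zeta> *\<^sub>C w)) 0"
    using fps_expansion_unique_complex has_fps_expansion_ball[OF h0] by blast
  \<comment> \<open>The factor \<open>\<zeta>\<close> in \<open>h\<close> raises the degree by one,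
    so derivative \<open>n + 1\<close> of \<open>h\<close> sees coefficient \<open>n\<close> of the
    slice of \<open>f\<close>.\<close>
  then have a: "(deriv ^^ Suc n) h 0 = fact (Suc n) * a n" for n
  proof -
    assume "fps_expansion h 0 = fps_X * fps_expansion (\<lambda>\<zeta>. f (\<zeta> *\<^sub>C w)) 0"
    then have "fps_nth (fps_expansion h 0) (Suc n) = a n" by (simp add: a_def)
    then show ?thesis by (simp add: fps_expansion_def field_simps del: fact_Suc funpow.simps)
  qed
  show "l (fderiv (fderiv F) 0 w w) = fact 2 * a 1"
    using d2[of 0] a[of 1] by (simp add: scaleC.zero_left numeral_2_eq_2)
  show "l (fderiv (fderiv (fderiv F)) 0 w w w) = fact 3 * a 2"
    using d3[of 0] a[of 2] by (simp add: scaleC.zero_left numeral_2_eq_2 numeral_3_eq_3)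
  show "l (fderiv (fderiv (fderiv (fderiv F))) 0 w w w w) = fact 4 * a 3"
    using d4[of 0] a[of 3] by (simp add: scaleC.zero_left eval_nat_numeral)
qed

section \<open>From starlike mappings to starlike functions on complex lines\<close>

lemma Re_times_of_real_pos_iff: "0 < r \<Longrightarrow> 0 < Re (q * complex_of_real r) \<longleftrightarrow> 0 < Re q"
  by (simp add: zero_less_mult_iff)

text \<open>The vector \<open>z\<close> is an eigenvector of \<open>D\<close> with eigenvalue
  \<open>a + m z\<close>.\<close>

lemma inv_scaleC_self:
  fixes z :: "'a::complex_normed_vector"
  assumes D: "\<And>v. D v = a *\<^sub>C v + m v *\<^sub>C z" and m: "bounded_clinear m"
    and "inj D" and nz: "a + m z \<noteq> 0"
  shows "inv D (a *\<^sub>C z) = (a / (a + m z)) *\<^sub>C z"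
proof (rule inv_f_eq[OF \<open>inj D\<close>])
  have "D ((a / (a + m z)) *\<^sub>C z) = ((a / (a + m z)) * (a + m z)) *\<^sub>C z"
    using bounded_clinearD(2)[OF m] unfolding D
    by (simp add: scaleC_scaleC distrib_left mult.commute add_divide_distrib flip: scaleC_add_left)
  then show "D ((a / (a + m z)) *\<^sub>C z) = a *\<^sub>C z" using nz by simp
qed

lemma starlike_scaleC_self:
  fixes F :: "'a::complex_normed_vector \<Rightarrow> 'a"
  assumes f: "frechet_holomorphic_on f (ball 0 1)"
    and F: "\<forall>z\<in>ball 0 1. F z = f z *\<^sub>C z"
    and star: "F \<in> starlike_mappings" and z: "z \<in> ball 0 1" "z \<noteq> 0"
  shows "0 < Re (f z / (f z + fderiv f z z))"
proof -
  have f': "has_cderiv f (fderiv f z) z" using f z by (simp add: frechet_holomorphic_on_iff)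
  note D = fderiv_scaleC_self(2)[OF f' F[rule_format] z(1)]
  have m: "bounded_clinear (fderiv f z)"
    using has_cderivD(2)[OF f'] by (simp add: bounded_clinear_def blinfun.bounded_linear_right)
  obtain G where G: "\<And>x. G (fderiv F z x) = x"
    using star z(1) unfolding starlike_mappings_def locally_biholomorphic_def by blast
  then have inj: "inj (fderiv F z)" by (rule inj_on_inverseI)
  \<comment> \<open>This is the eigenvalue of \<open>fderiv F z\<close> at \<open>z\<close>; were it
    zero, the derivative would send both \<open>z\<close> and 0 to 0, against injectivity.\<close>
  have nz: "f z + fderiv f z z \<noteq> 0"
  proof
    assume "f z + fderiv f z z = 0"
    then have "fderiv F z z = 0"
      using D[of z] scaleC_add_left[of "f z" "fderiv f z z" z] by (simp add: scaleC.zero_left)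
    then have "fderiv F z z = fderiv F z 0" by simp
    then show False using z(2) injD[OF inj] by blast
  qed
  obtain l where l: "l \<in> support_functionals z" using support_functionals_nonempty[OF z(2)] .
  have "0 < Re (l (inv (fderiv F z) (F z)))"
    using star z l by (auto simp: starlike_mappings_def)
  also have "inv (fderiv F z) (F z) = (f z / (f z + fderiv f z z)) *\<^sub>C z"
    unfolding F[rule_format, OF z(1)] by (rule inv_scaleC_self[OF D m inj nz])
  also have "l \<dots> = (f z / (f z + fderiv f z z)) * complex_of_real (norm z)"
    using bounded_clinearD(2)[OF support_functionalsD(1)[OF l]] support_functionalsD(2)[OF l] by simp
  finally show ?thesis
    by (rule iffD1[OF Re_times_of_real_pos_iff, rotated]) (use z(2) in simp)
qed

theorem starlike_scaleC_self_bound: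
  fixes F :: "'a::complex_banach \<Rightarrow> 'a"
  assumes f: "frechet_holomorphic_on f (ball 0 1)" and f0: "f 0 = 1"
    and F: "\<forall>z\<in>ball 0 1. F z = f z *\<^sub>C z"
    and star: "F \<in> starlike_mappings" and w: "norm w = 1"
  defines "a \<equiv> fps_nth (fps_expansion (\<lambda>\<zeta>. f (\<zeta> *\<^sub>C w)) 0)"
  shows "cmod (a 1 * a 2 - a 3) \<le> 2"
  unfolding a_def
proof (rule starlike_coefficient_bound)
  show k: "(\<lambda>\<zeta>. f (\<zeta> *\<^sub>C w)) holomorphic_on ball 0 1" by (rule holomorphic_on_slice[OF w f])
  show "f (0 *\<^sub>C w) = 1" by (simp add: f0 scaleC.zero_left)
  fix \<zeta> :: complex assume \<zeta>: "cmod \<zeta> < 1"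
  show "0 < Re (f (\<zeta> *\<^sub>C w) / (f (\<zeta> *\<^sub>C w) + \<zeta> * deriv (\<lambda>\<zeta>. f (\<zeta> *\<^sub>C w)) \<zeta>))"
  \<comment> \<open>The starlikeness condition excludes the origin, where the quotient is 1 because
    \<open>f 0 = 1\<close>.\<close>
  proof (cases "\<zeta> = 0")
    case True
    then show ?thesis by (simp add: f0 scaleC.zero_left)
  next
    case False
    note zin = scaleC_unit_in_ball[OF w \<zeta>]
    have "has_cderiv f (fderiv f (\<zeta> *\<^sub>C w)) (\<zeta> *\<^sub>C w)"
      using f zin by (simp add: frechet_holomorphic_on_iff)
    from has_cderivD(2)[OF this, of \<zeta> w]
    have "fderiv f (\<zeta> *\<^sub>C w) (\<zeta> *\<^sub>C w) = \<zeta> * deriv (\<lambda>\<zeta>. f (\<zeta> *\<^sub>C w)) \<zeta>"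
      using fderiv_along_line[OF w f bounded_linear_ident k refl \<zeta>] by simp
    moreover have "\<zeta> *\<^sub>C w \<noteq> 0"
      using False w by (metis mult_eq_0_iff norm_eq_zero norm_scaleC zero_neq_one)
    ultimately show ?thesis
      using starlike_scaleC_self[OF f F star zin] by simp
  qed
qed

section \<open>The extremal mapping of Koebe type\<close>

text \<open>The inverse of a rank-one perturbation of a scalar operator is explicit, by the
  Sherman-Morrison formula.\<close>

lemma bounded_clinear_rank_one_inverse:
  fixes z :: "'a::complex_normed_vector"
  assumes m: "bounded_clinear m" and a: "a \<noteq> 0" "a + m z \<noteq> 0"
    and D: "\<And>v. D v = a *\<^sub>C v + m v *\<^sub>C z"
  obtains G where "bounded_clinear G" "\<And>x. G (D x) = x" "\<And>x. D (G x) = x"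
proof
  define G where "G y = inverse a *\<^sub>C (y - (m y / (a + m z)) *\<^sub>C z)" for y
  note mC = bounded_clinearD(2)[OF m] and mL = bounded_linear.linear[OF bounded_clinearD(1)[OF m]]
  have "bounded_linear G"
    unfolding G_def divide_inverse
    by (intro bounded_linear_compose[OF scaleC.bounded_linear_right] bounded_linear_sub
        bounded_linear_ident bounded_linear_compose[OF scaleC.bounded_linear_left]
        bounded_linear_compose[OF bounded_linear_mult_left] bounded_clinearD(1)[OF m])
  moreover have "G (c *\<^sub>C x) = c *\<^sub>C G x" for c x
    by (simp add: G_def mC scaleC.diff_right scaleC_scaleC mult_ac)
  ultimately show "bounded_clinear G" by (simp add: bounded_clinear_def)
  show "G (D x) = x" for x
  proof -
    have "m (D x) = (a + m z) * m x"
      by (simp add: D linear_add[OF mL] mC algebra_simps)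
    then have "D x - (m (D x) / (a + m z)) *\<^sub>C z = a *\<^sub>C x" using a(2) by (simp add: D)
    then show ?thesis using a(1) by (simp add: G_def scaleC_scaleC)
  qed
  show "D (G x) = x" for x
  proof -
    have "m (G x) = inverse a * (m x - m x / (a + m z) * m z)"
      by (simp add: G_def mC linear_diff[OF mL])
    also have "\<dots> = m x / (a + m z)" using a by (simp add: field_simps)
    finally have "m (G x) = m x / (a + m z)" .
    then have "D (G x) = a *\<^sub>C G x + (m x / (a + m z)) *\<^sub>C z" by (simp only: D)
    also have "a *\<^sub>C G x = x - (m x / (a + m z)) *\<^sub>C z"
      using a(1) by (simp add: G_def scaleC_scaleC)
    finally show ?thesis by simp
  qed
qed

text \<open>When \<open>l\<close> supports a unit vector \<open>w\<close>, the mapping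
  \<open>koebe_factor l z *\<^sub>C z\<close> restricts on the line through \<open>w\<close> to the
  Koebe function \<open>\<zeta> / (1 - \<zeta>)\<^sup>2\<close> times \<open>w\<close>.\<close>

definition koebe_factor :: "('a \<Rightarrow> complex) \<Rightarrow> 'a \<Rightarrow> complex"
  where "koebe_factor l z = 1 / (1 - l z)\<^sup>2"

context
  fixes l :: "'a::complex_normed_vector \<Rightarrow> complex" and w :: 'a
  assumes l: "l \<in> support_functionals w"
begin

lemma koebe_factor_has_cderiv:
  assumes z: "z \<in> ball 0 1"
  obtains T where "has_cderiv (koebe_factor l) T z" "\<And>v. T v = 2 * l v / (1 - l z) ^ 3"
proof
  note lc = support_functionalsD(1)[OF l]
  have nz: "1 - l z \<noteq> 0" using support_functionalsD(3)[OF l, of z] z by auto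
  define T where "T = Blinfun (\<lambda>v. (2 / (1 - l z) ^ 3) * l v)"
  have T: "blinfun_apply T = (\<lambda>v. (2 / (1 - l z) ^ 3) * l v)"
    unfolding T_def
    by (rule bounded_linear_Blinfun_apply)
       (rule bounded_linear_compose[OF bounded_linear_mult_right bounded_clinearD(1)[OF lc]])
  have "((\<lambda>s. 1 / (1 - s)\<^sup>2) has_field_derivative 2 / (1 - l z) ^ 3) (at (l z))"
  proof -
    have "((\<lambda>s. (1 - s)\<^sup>2) has_field_derivative - 2 * (1 - l z)) (at (l z))"
      by (auto intro!: derivative_eq_intros)
    from DERIV_divide[OF DERIV_const[of 1] this]
    have "((\<lambda>s. 1 / (1 - s)\<^sup>2) has_field_derivative 2 * (1 - l z) / ((1 - l z)\<^sup>2 * (1 - l z)\<^sup>2)) (at (l z))"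
      using nz by simp
    also have "2 * (1 - l z) / ((1 - l z)\<^sup>2 * (1 - l z)\<^sup>2) = 2 / (1 - l z) ^ 3"
    proof -
      have "2 * t / (t\<^sup>2 * t\<^sup>2) = 2 / t ^ 3" if "t \<noteq> 0" for t :: complex
        using that by (simp add: power2_eq_square power3_eq_cube)
      from this[OF nz] show ?thesis .
    qed
    finally show ?thesis .
  qed
  then have "((\<lambda>z. 1 / (1 - l z)\<^sup>2) has_derivative (\<lambda>v. (2 / (1 - l z) ^ 3) * l v)) (at z)"
    unfolding has_field_derivative_def
    by (rule has_derivative_compose[OF bounded_linear_imp_has_derivative[OF bounded_clinearD(1)[OF lc]]])
  then show "has_cderiv (koebe_factor l) T z"
    using bounded_clinearD(2)[OF lc] by (simp add: has_cderiv_def T koebe_factor_def[abs_def])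
  show "T v = 2 * l v / (1 - l z) ^ 3" for v by (simp add: T)
qed

lemma koebe_factor_holomorphic: "frechet_holomorphic_on (koebe_factor l) (ball 0 1)"
  unfolding frechet_holomorphic_on_iff
  using koebe_factor_has_cderiv has_cderiv_imp_fderiv by metis

text \<open>At every \<open>z\<close> in the ball the relevant quotient is
  \<open>(1 - s) / (1 + s)\<close> with \<open>s = l z\<close> in the unit disc, a Moebius map of
  the disc onto the right half-plane.\<close>

lemma koebe_factor_starlike: "(\<lambda>z. koebe_factor l z *\<^sub>C z) \<in> starlike_mappings"
proof -
  let ?f = "koebe_factor l" and ?F = "\<lambda>z. koebe_factor l z *\<^sub>C z"
  note lc = support_functionalsD(1)[OF l]
  have l0: "l 0 = 0" using linear_0[OF bounded_linear.linear[OF bounded_clinearD(1)[OF lc]]] .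
  have key: "has_cderiv ?F (fderiv ?F z) z"
      "\<exists>m. bounded_clinear m \<and> (\<forall>v. fderiv ?F z v = ?f z *\<^sub>C v + m v *\<^sub>C z) \<and>
        ?f z \<noteq> 0 \<and> ?f z + m z \<noteq> 0 \<and> ?f z / (?f z + m z) = (1 - l z) / (1 + l z)"
    if z: "z \<in> ball 0 1" for z
  proof -
    obtain T where T: "has_cderiv ?f T z" "\<And>v. T v = 2 * l v / (1 - l z) ^ 3"
      using koebe_factor_has_cderiv[OF z] by blast
    show "has_cderiv ?F (fderiv ?F z) z" by (rule fderiv_scaleC_self(1)[OF T(1) refl z])
    have "cmod (l z) < 1" using support_functionalsD(3)[OF l, of z] z by simp
    then have "l z \<noteq> 1" "l z \<noteq> - 1" by auto
    then have nz: "1 - l z \<noteq> 0" "1 + l z \<noteq> 0" by (auto simp: add_eq_0_iff)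
    \<comment> \<open>The cubic denominator of the derivative is used for
      \<open>koebe_factor l z\<close> as well, so that the two fractions add up directly.\<close>
    have f3: "?f z = (1 - l z) / (1 - l z) ^ 3"
      using nz(1) by (simp add: koebe_factor_def power2_eq_square power3_eq_cube)
    have sum: "?f z + T z = (1 + l z) / (1 - l z) ^ 3"
      unfolding f3 T(2) by (simp flip: add_divide_distrib)
    show "\<exists>m. bounded_clinear m \<and> (\<forall>v. fderiv ?F z v = ?f z *\<^sub>C v + m v *\<^sub>C z) \<and>
        ?f z \<noteq> 0 \<and> ?f z + m z \<noteq> 0 \<and> ?f z / (?f z + m z) = (1 - l z) / (1 + l z)"
    proof (intro exI[of _ "blinfun_apply T"] conjI allI)
      show "bounded_clinear T"
        using has_cderivD(2)[OF T(1)] by (simp add: bounded_clinear_def blinfun.bounded_linear_right)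
      show "fderiv ?F z v = ?f z *\<^sub>C v + T v *\<^sub>C z" for v
        by (rule fderiv_scaleC_self(2)[OF T(1) refl z])
      show "?f z \<noteq> 0" "?f z + T z \<noteq> 0" using nz by (simp_all only: sum) (simp_all add: koebe_factor_def)
      show "?f z / (?f z + T z) = (1 - l z) / (1 + l z)"
        unfolding sum unfolding f3 using nz by simp
    qed
  qed
  have "fderiv ?F 0 = id_blinfun"
  proof (rule blinfun_eqI)
    fix v
    obtain m where "\<forall>v. fderiv ?F 0 v = ?f 0 *\<^sub>C v + m v *\<^sub>C 0" using key(2)[of 0] by auto
    then show "fderiv ?F 0 v = id_blinfun v"
      by (simp add: koebe_factor_def l0 scaleC.zero_right)
  qed
  then have "normalized ?F"
    using key(1) by (auto simp: normalized_def frechet_holomorphic_on_iff scaleC.zero_right)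
  moreover have "locally_biholomorphic ?F"
    unfolding locally_biholomorphic_def
  proof
    fix z :: 'a assume "z \<in> ball 0 1"
    from key(2)[OF this] obtain m where m: "bounded_clinear m" "?f z \<noteq> 0" "?f z + m z \<noteq> 0"
      "\<And>v. fderiv ?F z v = ?f z *\<^sub>C v + m v *\<^sub>C z" by blast
    show "\<exists>G. bounded_clinear G \<and> (\<forall>x. G (fderiv ?F z x) = x) \<and> (\<forall>x. fderiv ?F z (G x) = x)"
      by (rule bounded_clinear_rank_one_inverse[OF m]) blast
  qed
  moreover have "0 < Re (l' (inv (fderiv ?F z) (?F z)))"
    if z: "z \<in> ball 0 1 - {0}" and l': "l' \<in> support_functionals z" for z l'
  proof -
    from z have zb: "z \<in> ball 0 1" by simp
    from key(2)[OF zb] obtain m where m: "bounded_clinear m" "?f z \<noteq> 0" "?f z + m z \<noteq> 0"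
      "\<And>v. fderiv ?F z v = ?f z *\<^sub>C v + m v *\<^sub>C z" "?f z / (?f z + m z) = (1 - l z) / (1 + l z)" by blast
    obtain G where "\<And>x. G (fderiv ?F z x) = x"
      by (rule bounded_clinear_rank_one_inverse[OF m(1-4)]) blast
    then have "inj (fderiv ?F z)" by (rule inj_on_inverseI)
    from inv_scaleC_self[OF m(4,1) this m(3)]
    have "inv (fderiv ?F z) (?F z) = ((1 - l z) / (1 + l z)) *\<^sub>C z" by (simp only: m(5))
    then have "l' (inv (fderiv ?F z) (?F z)) = (1 - l z) / (1 + l z) * complex_of_real (norm z)"
      using bounded_clinearD(2)[OF support_functionalsD(1)[OF l']] support_functionalsD(2)[OF l'] by simp
    moreover have "0 < Re ((1 - l z) / (1 + l z))"
    proof -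
      have s: "cmod (l z) < 1" using support_functionalsD(3)[OF l, of z] zb by simp
      then have "l z \<noteq> - 1" by auto
      then have "1 + l z \<noteq> 0" by (auto simp: add_eq_0_iff)
      \<comment> \<open>The real part of \<open>(1 - s) / (1 + s)\<close> has the sign of
        \<open>1 - (cmod s)\<^sup>2\<close>.\<close>
      have "(cmod (l z))\<^sup>2 < 1" using s by (simp add: power_less_one_iff abs_square_less_1)
      then have "(Re (l z))\<^sup>2 + (Im (l z))\<^sup>2 < 1" by (simp only: cmod_power2)
      then have "0 < (1 - Re (l z)) * (1 + Re (l z)) - Im (l z) * Im (l z)"
        by (simp add: power2_eq_square algebra_simps)
      then show ?thesis
        using \<open>1 + l z \<noteq> 0\<close> by (simp add: Re_divide' zero_less_divide_iff)
    qed
    moreover have "0 < norm z" using z by simp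
    ultimately show ?thesis by (simp only: Re_times_of_real_pos_iff)
  qed
  ultimately show ?thesis by (auto simp: starlike_mappings_def)
qed

lemma koebe_factor_coeffs:
  assumes w: "norm w = 1"
  defines "a \<equiv> fps_nth (fps_expansion (\<lambda>\<zeta>. koebe_factor l (\<zeta> *\<^sub>C w)) 0)"
  shows "a 1 = 2" "a 2 = 3" "a 3 = 4"
proof -
  let ?k = "\<lambda>\<zeta>. koebe_factor l (\<zeta> *\<^sub>C w)"
  define K where "K = fps_expansion ?k 0"
  have k: "?k \<zeta> = 1 / (1 - \<zeta>)\<^sup>2" for \<zeta>
    using bounded_clinearD(2)[OF support_functionalsD(1)[OF l]] support_functionalsD(2)[OF l] w
    by (simp add: koebe_factor_def)
  have "?k holomorphic_on ball 0 1" by (rule holomorphic_on_slice[OF w koebe_factor_holomorphic])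
  then have "(\<lambda>\<zeta>. ?k \<zeta> * ((1 - \<zeta>) * (1 - \<zeta>))) has_fps_expansion K * ((1 - fps_X) * (1 - fps_X))"
    unfolding K_def by (intro fps_expansion_intros has_fps_expansion_ball)
  moreover have "(\<lambda>\<zeta>::complex. 1) has_fps_expansion 1" by simp
  ultimately have "K * ((1 - fps_X) * (1 - fps_X)) = 1"
    by (rule has_fps_expansion_unique_ball) (auto simp: k power2_eq_square)
  \<comment> \<open>In this form the coefficients of \<open>K * (1 - fps_X)\<close> are all seen to
    be 1, so consecutive coefficients of \<open>K\<close> differ by 1.\<close>
  then have "K * (1 - fps_X) = K * (1 - fps_X) * fps_X + 1"
    by (simp add: algebra_simps)
  then have e: "fps_nth (K * (1 - fps_X)) n = fps_nth (K * (1 - fps_X) * fps_X + 1) n" for n by simp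
  have "fps_nth K 0 = 1" using e[of 0] by simp
  then show "a 1 = 2" "a 2 = 3" "a 3 = 4"
    using e[of 1] e[of 2] e[of 3]
    by (simp_all add: a_def eval_nat_numeral right_diff_distrib algebra_simps flip: K_def)
qed

end

section \<open>The sharp bound\<close>

theorem theorem5:
  assumes "(UNIV :: 'a::complex_banach set) \<noteq> {0}"
  shows
    "(\<forall>(f :: 'a \<Rightarrow> complex) (F :: 'a \<Rightarrow> 'a).
        frechet_holomorphic_on f (ball 0 1) \<and> f 0 = 1 \<and>
        (\<forall>z\<in>ball 0 1. F z = f z *\<^sub>C z) \<and> F \<in> starlike_mappings \<longrightarrow>
        (\<forall>z l. z \<noteq> 0 \<and> l \<in> support_functionals z \<longrightarrow>
           cmod ((l (fderiv (fderiv F) 0 z z) / (fact 2 * complex_of_real (norm z) ^ 2)) *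
                 (l (fderiv (fderiv (fderiv F)) 0 z z z) / (fact 3 * complex_of_real (norm z) ^ 3)) -
                 l (fderiv (fderiv (fderiv (fderiv F))) 0 z z z z) /
                   (fact 4 * complex_of_real (norm z) ^ 4)) \<le> 2))
     \<and>
     (\<forall>C :: real.
        (\<forall>(f :: 'a \<Rightarrow> complex) (F :: 'a \<Rightarrow> 'a).
          frechet_holomorphic_on f (ball 0 1) \<and> f 0 = 1 \<and>
          (\<forall>z\<in>ball 0 1. F z = f z *\<^sub>C z) \<and> F \<in> starlike_mappings \<longrightarrow>
          (\<forall>z l. z \<noteq> 0 \<and> l \<in> support_functionals z \<longrightarrow>
             cmod ((l (fderiv (fderiv F) 0 z z) / (fact 2 * complex_of_real (norm z) ^ 2)) *
                   (l (fderiv (fderiv (fderiv F)) 0 z z z) / (fact 3 * complex_of_real (norm z) ^ 3)) -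
                   l (fderiv (fderiv (fderiv (fderiv F))) 0 z z z z) /
                     (fact 4 * complex_of_real (norm z) ^ 4)) \<le> C))
        \<longrightarrow> 2 \<le> C)"
proof (intro conjI allI impI, goal_cases)
  case (1 f F z l)
  then have f: "frechet_holomorphic_on f (ball 0 1)" and f0: "f 0 = 1"
    and F: "\<forall>z\<in>ball 0 1. F z = f z *\<^sub>C z" and star: "F \<in> starlike_mappings"
    and z: "z \<noteq> 0" and l: "l \<in> support_functionals z" by auto
  \<comment> \<open>All terms are homogeneous, so the claim is reduced to the unit vector
    \<open>w\<close>, which has \<open>l\<close> as a support functional too.\<close>
  obtain N w where N: "norm z = N" "N \<noteq> 0" and w: "norm w = 1" and zw: "z = N *\<^sub>R w"
  proof
    show "norm (z /\<^sub>R norm z) = 1" "z = norm z *\<^sub>R (z /\<^sub>R norm z)" "norm z \<noteq> 0"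
      using z by simp_all
  qed simp
  have lR: "l (r *\<^sub>R x) = complex_of_real r * l x" for r x
    using linear_scale[OF bounded_linear.linear[OF bounded_clinearD(1)[OF support_functionalsD(1)[OF l]]]]
    by (simp add: scaleR_conv_of_real)
  have lw: "l \<in> support_functionals w"
    using l N w by (simp add: support_functionals_def lR zw)
  note c = fderiv_scaleC_self_coeffs[OF f F w lw]
  have hom: "l (fderiv (fderiv F) 0 z z) = complex_of_real N ^ 2 * l (fderiv (fderiv F) 0 w w)"
    "l (fderiv (fderiv (fderiv F)) 0 z z z) = complex_of_real N ^ 3 * l (fderiv (fderiv (fderiv F)) 0 w w w)"
    "l (fderiv (fderiv (fderiv (fderiv F))) 0 z z z z)
      = complex_of_real N ^ 4 * l (fderiv (fderiv (fderiv (fderiv F))) 0 w w w w)"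
    unfolding zw
    by (simp_all add: blinfun.scaleR_right blinfun.scaleR_left lR eval_nat_numeral mult_ac)
  have cancel: "complex_of_real N ^ n * (fact m * y) / (fact m * complex_of_real N ^ n) = y" for n m y
    using N(2) by simp
  show ?case
    unfolding hom c N(1) cancel by (rule starlike_scaleC_self_bound[OF f f0 F star w])
next
  case (2 C)
  obtain u :: 'a where "u \<noteq> 0" using assms by auto
  define w where "w = u /\<^sub>R norm u"
  have w: "norm w = 1" "w \<noteq> 0" using \<open>u \<noteq> 0\<close> by (simp_all add: w_def)
  obtain l where l: "l \<in> support_functionals w" using support_functionals_nonempty[OF w(2)] .
  have l0: "koebe_factor l 0 = 1"
    using linear_0[OF bounded_linear.linear[OF bounded_clinearD(1)[OF support_functionalsD(1)[OF l]]]]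
    by (simp add: koebe_factor_def)
  note c = fderiv_scaleC_self_coeffs[OF koebe_factor_holomorphic[OF l] ballI[OF refl] w(1) l]
  note k = koebe_factor_coeffs[OF l w(1)]
  note 2[rule_format, of "koebe_factor l" "\<lambda>z. koebe_factor l z *\<^sub>C z" w l]
  \<comment> \<open>The Koebe coefficients 2, 3, 4 give exactly the value 2.\<close>
  then have "cmod (2 * 3 - 4) \<le> C"
    using koebe_factor_holomorphic[OF l] koebe_factor_starlike[OF l] l0 w l by (simp add: c k k(1)[simplified])
  then show ?case by simp
qed

end
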